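(* Let $\mathtt g,d$ be positive integers and let $\mathcal H$ be a complex Hilbert space. If $\varphi:\mathcal A_{2d+2}\to\mathbb C$ is a linear functional that is continuous in the product weak operator topology and satisfies $\varphi(p^*p)\ge0$ for all $p\in\mathcal A_{d+1}$, then there exist a finite-dimensional Hilbert space $\mathcal E$, a tuple $Y=(Y_1,\dots,Y_{\mathtt g})$ of self-adjoint operators on $\mathcal E$, and a vector $\gamma\in\mathcal H\otimes\mathcal E$ such that $$\varphi(q^*p)=\langle p(Y)\gamma,\ q(Y)\gamma\rangle_{\mathcal H\otimes\mathcal E}\qquad\text{for all }p\in\mathcal A_{d+1},\ q\in\mathcal A_d.$$ Therefore, for all $p\in\mathcal A_{2d+1}$, $$\varphi(p)=\langle p(Y)\gamma,\ \gamma\rangle.$$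
   Context: $\langle x\rangle_d$ is the set of words of length at most $d$ in the free monoid on $x_1,\dots,x_{\mathtt g}$. $\mathcal A=\mathcal B(\mathcal H)\otimes\mathbb C\langle x\rangle$ consists of finite sums $p=\sum_wP_ww$, $P_w\in\mathcal B(\mathcal H)$, with involution $p^*=\sum_wP_w^*w^*$, $(x_{i_1}\cdots x_{i_n})^*=x_{i_n}\cdots x_{i_1}$; $\mathcal A_d$ is the subspace of polynomials of degree at most $d$. For a tuple $Y$ of operators on $\mathcal E$, $p(Y)=\sum_wP_w\otimes Y^w$ on $\mathcal H\otimes\mathcal E$, where $Y^w=Y_{i_1}\cdots Y_{i_n}$ for $w=x_{i_1}\cdots x_{i_n}$. The product weak operator topology on $\mathcal A_{2d+2}$ is that of coefficientwise WOT convergence, i.e. the product WOT on $\mathcal B(\mathcal H)^{\langle x\rangle_{2d+2}}$ under $p\mapsto(P_w)_w$. Inner products are linear in the first argument. *)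

theory Defs
  imports "HOL-Analysis.Function_Topology" "Jordan_Normal_Form.Matrix"
begin

section \<open>Complex Hilbert spaces\<close>

text \<open>
  The inner product is linear in the first argument. The last axiom says at once that
  \<open>cinner x x\<close> is a nonnegative real, that \<open>cinner\<close> is definite, and that it induces the
  (complete) norm inherited from \<^class>\<open>banach\<close>. The class contains the zero space.
\<close>

class complex_hilbert = banach +
  fixes scaleC :: "complex \<Rightarrow> 'a \<Rightarrow> 'a"  (infixr "*\<^sub>C" 75)
    and cinner :: "'a \<Rightarrow> 'a \<Rightarrow> complex"
  assumes scaleC_add_right: "c *\<^sub>C (x + y) = c *\<^sub>C x + c *\<^sub>C y"
    and scaleC_add_left: "(b + c) *\<^sub>C x = b *\<^sub>C x + c *\<^sub>C x"
    and scaleC_scaleC: "b *\<^sub>C c *\<^sub>C x = (b * c) *\<^sub>C x"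
    and scaleR_scaleC: "scaleR r x = complex_of_real r *\<^sub>C x"
    and cinner_add_left: "cinner (x + y) z = cinner x z + cinner y z"
    and cinner_scaleC_left: "cinner (c *\<^sub>C x) y = c * cinner x y"
    and cinner_commute: "cinner y x = cnj (cinner x y)"
    and cinner_self: "cinner x x = complex_of_real ((norm x)\<^sup>2)"

instantiation complex :: complex_hilbert
begin
definition "scaleC_complex (c::complex) x = c * x"
definition "cinner_complex (x::complex) y = x * cnj y"
instance
proof
  show "cinner x x = complex_of_real ((norm x)\<^sup>2)" for x :: complex
    unfolding cinner_complex_def by (rule complex_norm_square[symmetric])
qed (simp_all add: scaleC_complex_def cinner_complex_def distrib_left distrib_right mult.assoc
      scaleR_conv_of_real)
end

lemma cinner_ext:
  fixes u v :: "'h::complex_hilbert"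
  assumes "\<And>x. cinner x u = cinner x v"
  shows "u = v"
proof -
  have *: "cinner u x = cinner v x" for x
    unfolding cinner_commute[of u x] cinner_commute[of v x] assms ..
  have "cinner (u - v) (u - v) + cinner v (u - v) = cinner u (u - v)"
    unfolding cinner_add_left[symmetric] diff_add_cancel ..
  then have "complex_of_real ((norm (u - v))\<^sup>2) = 0"
    unfolding * cinner_self by simp
  then show ?thesis
    by simp
qed

definition bounded_clinear :: "('h::complex_hilbert \<Rightarrow> 'h) \<Rightarrow> bool" where
  "bounded_clinear A \<longleftrightarrow> bounded_linear A \<and> (\<forall>c x. A (c *\<^sub>C x) = c *\<^sub>C A x)"

definition cadjoint :: "('h::complex_hilbert \<Rightarrow> 'h) \<Rightarrow> ('h \<Rightarrow> 'h)" where
  "cadjoint A = (THE B. bounded_clinear B \<and> (\<forall>x y. cinner (A x) y = cinner x (B y)))"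

lemma cadjoint_eqI:
  assumes "bounded_clinear B" "\<And>x y. cinner (A x) y = cinner x (B y)"
  shows "cadjoint A = B"
  unfolding cadjoint_def
proof (rule the_equality)
  fix C assume "bounded_clinear C \<and> (\<forall>x y. cinner (A x) y = cinner x (C y))"
  then have eq: "cinner x (C y) = cinner x (B y)" for x y
    using assms(2)[of x y] by simp
  show "C = B"
  proof
    show "C y = B y" for y
      by (rule cinner_ext) (rule eq)
  qed
qed (use assms in blast)

text \<open>The weak operator topology on the bounded operators: the coarsest topology for which all
  functionals \<open>A \<mapsto> \<langle>A x, y\<rangle>\<close> are continuous.\<close>

definition wot :: "('h::complex_hilbert \<Rightarrow> 'h) topology" where
  "wot = topology_generated_by
     {{A. bounded_clinear A \<and> cinner (A x) y \<in> U} | x y U. open U}"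

lemma topspace_wot: "topspace (wot :: ('h::complex_hilbert \<Rightarrow> 'h) topology) = Collect bounded_clinear"
proof -
  have "{A :: 'h \<Rightarrow> 'h. bounded_clinear A} \<in> {{A. bounded_clinear A \<and> cinner (A x) y \<in> U} | x y U. open U}"
    by (rule CollectI, rule exI[of _ 0], rule exI[of _ 0], rule exI[of _ UNIV]) simp
  then show ?thesis
    unfolding wot_def topology_generated_by_topspace by blast
qed


section \<open>Noncommutative polynomials with operator coefficients\<close>

text \<open>The word \<open>x\<^sub>i\<^sub>1 \<cdots> x\<^sub>i\<^sub>n\<close> is the list \<open>[i\<^sub>1, \<dots>, i\<^sub>n]\<close>, with the letters indexed
  by \<open>0, \<dots>, g - 1\<close>.\<close>

definition words_le :: "nat \<Rightarrow> nat \<Rightarrow> nat list set" where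
  "words_le g k = {w. set w \<subseteq> {..<g} \<and> length w \<le> k}"

type_synonym 'h ncpoly = "nat list \<Rightarrow> 'h \<Rightarrow> 'h"

definition nc_support :: "'h::zero ncpoly \<Rightarrow> nat list set" where
  "nc_support p = {w. p w \<noteq> (\<lambda>_. 0)}"

definition ncpolys :: "nat \<Rightarrow> 'h::complex_hilbert ncpoly set" where
  "ncpolys g = {p. (\<forall>w. bounded_clinear (p w)) \<and> finite (nc_support p)
                   \<and> (\<forall>w \<in> nc_support p. set w \<subseteq> {..<g})}"

definition ncpolys_le :: "nat \<Rightarrow> nat \<Rightarrow> 'h::complex_hilbert ncpoly set" where
  "ncpolys_le g k = {p \<in> ncpolys g. \<forall>w \<in> nc_support p. length w \<le> k}"

lemma ncpolys_le_iff:
  "p \<in> ncpolys_le g k \<longleftrightarrow> (\<forall>w. bounded_clinear (p w)) \<and> nc_support p \<subseteq> words_le g k"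
proof -
  have "finite (words_le g k)"
    unfolding words_le_def using finite_lists_length_le[of "{..<g}" k] by simp
  then show ?thesis
    by (auto simp: ncpolys_le_def ncpolys_def words_le_def intro: finite_subset)
qed

definition nc_add :: "'h::complex_hilbert ncpoly \<Rightarrow> 'h ncpoly \<Rightarrow> 'h ncpoly" where
  "nc_add p q = (\<lambda>w x. p w x + q w x)"

definition nc_scale :: "complex \<Rightarrow> 'h::complex_hilbert ncpoly \<Rightarrow> 'h ncpoly" where
  "nc_scale c p = (\<lambda>w x. c *\<^sub>C p w x)"

text \<open>The coefficient of \<open>w\<close> in \<open>p q\<close> is the sum of \<open>P\<^sub>u Q\<^sub>v\<close> over all factorizations
  \<open>w = u v\<close>.\<close>

definition nc_mult :: "'h::complex_hilbert ncpoly \<Rightarrow> 'h ncpoly \<Rightarrow> 'h ncpoly" where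
  "nc_mult p q = (\<lambda>w x. \<Sum>i\<le>length w. p (take i w) (q (drop i w) x))"

definition nc_star :: "'h::complex_hilbert ncpoly \<Rightarrow> 'h ncpoly" where
  "nc_star p = (\<lambda>w. cadjoint (p (rev w)))"

definition nc_linear_functional :: "nat \<Rightarrow> nat \<Rightarrow> ('h::complex_hilbert ncpoly \<Rightarrow> complex) \<Rightarrow> bool" where
  "nc_linear_functional g k \<phi> \<longleftrightarrow>
     (\<forall>p \<in> ncpolys_le g k. \<forall>q \<in> ncpolys_le g k. \<phi> (nc_add p q) = \<phi> p + \<phi> q) \<and>
     (\<forall>p \<in> ncpolys_le g k. \<forall>c. \<phi> (nc_scale c p) = c * \<phi> p)"

definition nc_product_wot :: "nat \<Rightarrow> nat \<Rightarrow> 'h::complex_hilbert ncpoly topology" where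
  "nc_product_wot g k =
     pullback_topology (ncpolys_le g k) (\<lambda>p. restrict p (words_le g k))
       (product_topology (\<lambda>_. wot) (words_le g k))"

lemma topspace_nc_product_wot: "topspace (nc_product_wot g k) = ncpolys_le g k"
  by (auto simp: nc_product_wot_def topspace_pullback_topology topspace_wot ncpolys_le_iff)


section \<open>Evaluation on a finite-dimensional Hilbert space\<close>

text \<open>
  Finite-dimensional Hilbert spaces \<open>E\<close> are taken to be \<open>\<complex>\<^sup>n\<close>, i.e. \<open>carrier_vec n\<close> with the
  inner product \<open>u \<bullet>c v\<close>, linear in \<open>u\<close>; operators on \<open>E\<close> are \<open>n \<times> n\<close> matrices. The Hilbert
  tensor product \<open>H \<otimes> E\<close> is \<open>H\<^sup>n\<close>, i.e. \<open>carrier_vec n\<close> over \<open>H\<close>. The lemmas below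
  show that this is a model of the tensor product.
\<close>

definition self_adjoint_on :: "nat \<Rightarrow> complex mat \<Rightarrow> bool" where
  "self_adjoint_on n Y \<longleftrightarrow> Y \<in> carrier_mat n n \<and>
     (\<forall>u \<in> carrier_vec n. \<forall>v \<in> carrier_vec n. (Y *\<^sub>v u) \<bullet>c v = u \<bullet>c (Y *\<^sub>v v))"

definition tensor_space :: "nat \<Rightarrow> 'h::complex_hilbert vec set" where
  "tensor_space n = carrier_vec n"

definition tensor_cinner :: "'h::complex_hilbert vec \<Rightarrow> 'h vec \<Rightarrow> complex" where
  "tensor_cinner u v = (\<Sum>i<dim_vec u. cinner (u $ i) (v $ i))"

definition tensor_vec :: "'h::complex_hilbert \<Rightarrow> complex vec \<Rightarrow> 'h vec" where
  "tensor_vec h e = vec (dim_vec e) (\<lambda>i. e $ i *\<^sub>C h)"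

definition tensor_op :: "('h::complex_hilbert \<Rightarrow> 'h) \<Rightarrow> complex mat \<Rightarrow> 'h vec \<Rightarrow> 'h vec" where
  "tensor_op A M v = vec (dim_row M) (\<lambda>i. \<Sum>j<dim_col M. M $$ (i, j) *\<^sub>C A (v $ j))"

lemma scaleC_sum_left: "sum f S *\<^sub>C (x::'h::complex_hilbert) = (\<Sum>i\<in>S. f i *\<^sub>C x)"
proof -
  have "0 *\<^sub>C x = 0"
    using scaleC_add_left[of 0 0 x] by simp
  then show ?thesis
    by (induction S rule: infinite_finite_induct) (auto simp: scaleC_add_left)
qed

lemma tensor_cinner_tensor_vec:
  assumes "d \<in> carrier_vec n" "e \<in> carrier_vec n"
  shows "tensor_cinner (tensor_vec h d) (tensor_vec k e) = cinner h k * (d \<bullet>c e)"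
proof -
  have "cinner h (c *\<^sub>C k) = cnj c * cinner h k" for c
    by (metis cinner_commute cinner_scaleC_left complex_cnj_mult)
  then show ?thesis
    using assms by (simp add: tensor_cinner_def tensor_vec_def scalar_prod_def sum_distrib_left
        cinner_scaleC_left atLeast0LessThan mult_ac)
qed

lemma tensor_op_tensor_vec:
  assumes "bounded_clinear A" "M \<in> carrier_mat n n" "e \<in> carrier_vec n"
  shows "tensor_op A M (tensor_vec h e) = tensor_vec (A h) (M *\<^sub>v e)"
  using assms
  by (auto simp: tensor_op_def tensor_vec_def scalar_prod_def bounded_clinear_def
      scaleC_scaleC scaleC_sum_left atLeast0LessThan)

lemma tensor_space_span:
  assumes "v \<in> tensor_space n" "i < n"
  shows "v $ i = (\<Sum>j<n. tensor_vec (v $ j) (unit_vec n j) $ i)"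
proof -
  have zero: "0 *\<^sub>C x = 0" and one: "1 *\<^sub>C x = x" for x :: 'a
    using scaleR_scaleC[of 0 x] scaleR_scaleC[of 1 x] by simp_all
  have "(\<Sum>j<n. tensor_vec (v $ j) (unit_vec n j) $ i) = (\<Sum>j<n. if j = i then v $ j else 0)"
    using assms by (intro sum.cong) (auto simp: tensor_vec_def zero one)
  then show ?thesis
    using assms by simp
qed

definition mat_word :: "nat \<Rightarrow> (nat \<Rightarrow> complex mat) \<Rightarrow> nat list \<Rightarrow> complex mat" where
  "mat_word n Y w = foldr (\<lambda>i M. Y i * M) w (1\<^sub>m n)"

definition nc_eval :: "nat \<Rightarrow> (nat \<Rightarrow> complex mat) \<Rightarrow> 'h::complex_hilbert ncpoly \<Rightarrow> 'h vec \<Rightarrow> 'h vec" where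
  "nc_eval n Y p v = vec n (\<lambda>i. \<Sum>w\<in>nc_support p. tensor_op (p w) (mat_word n Y w) v $ i)"

end

theory Submission
  imports Defs "HOL-Library.Function_Algebras"
begin

text \<open>
  A functional that is continuous for the product weak operator topology only looks at finitely
  many vectors of \<open>H\<close>, so it is a finite combination of the entries \<open>\<langle>P\<^sub>w e\<^sub>a, e\<^sub>b\<rangle>\<close> for an
  orthonormal system \<open>e\<^sub>0, \<dots>, e\<^sub>m\<^sub>-\<^sub>1\<close> (\<open>wot_continuous_expansion\<close>):
  \<open>\<phi>(p) = \<Sum> \<langle>P\<^sub>w e\<^sub>a, e\<^sub>b\<rangle> c\<^sub>w(a, b)\<close>. Hence \<open>\<phi>\<close> amounts to a truncated sequence \<open>c\<close> of
  \<open>m \<times> m\<close> matrix moments indexed by words.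

  Since \<open>\<phi>(q\<^sup>* p) = \<Sum> \<langle>P\<^sub>v e\<^sub>a, Q\<^sub>u e\<^sub>b\<rangle> c\<^bsub>u\<^sup>* v\<^esub>(a, b)\<close> and the vectors \<open>P\<^sub>v e\<^sub>a\<close> may be
  prescribed freely, positivity of \<open>\<phi>\<close> on squares, applied with all \<open>P\<^sub>v e\<^sub>a\<close> multiples of one
  unit vector, says that the Hankel form
  \<open>B(t, s) = \<Sum> c\<^bsub>u\<^sup>* v\<^esub>(a, b) t(v, a) \<cdot> cnj s(u, b)\<close> on words of length at most \<open>d + 1\<close> is
  positive semidefinite.

  The GNS construction then yields the operators (\<open>truncated_matrix_moments\<close>). Let \<open>E\<close> be the
  quotient by the null vectors of the span of words of length at most \<open>d\<close>. Prefixing a letter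
  \<open>x\<^sub>k\<close> leads from degree \<open>d\<close> to degree \<open>d + 1\<close>, and projecting back to \<open>E\<close> gives \<open>Y\<^sub>k\<close>. It is
  self-adjoint because \<open>c\<close> is Hankel, and the projection is harmless because it has an effect only
  in the last step towards length \<open>d + 1\<close>, where the result is paired with vectors of \<open>E\<close>. With
  \<open>[w, a]\<close> the element of \<open>E\<close> given by the word \<open>w\<close> and the index \<open>a\<close>, and with
  \<open>\<gamma> = \<Sum> e\<^sub>a \<otimes> [1, a]\<close> the two asserted formulas are read off from
  \<open>\<langle>Y\<^sup>w [1, a], [1, b]\<rangle> = c\<^sub>w(a, b)\<close>, which holds for words of length at most \<open>2 d + 1\<close>.

  Quotients and projections are never formed: an orthonormal system \<open>u\<close> for a semidefinite form
  with the Parseval identity \<open>B x y = \<Sum> B x u\<^sub>i \<cdot> B u\<^sub>i y\<close> (\<open>orthonormal_Parseval\<close>) supplies the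
  coordinates of \<open>E\<close>, and \<open>Y\<^sub>k\<close> is the matrix of the compressed shift in them
  (\<open>compression_matrix\<close>). The same lemma yields the system \<open>e\<close> in \<open>H\<close>.
\<close>

section \<open>Positive semidefinite sesquilinear forms\<close>

locale positive_form = vector_space scale
  for scale :: "complex \<Rightarrow> 'v::ab_group_add \<Rightarrow> 'v" +
  fixes B :: "'v \<Rightarrow> 'v \<Rightarrow> complex"
  assumes add_left: "B (x + y) z = B x z + B y z"
    and scale_left: "B (scale c x) y = c * B x y"
    and add_right: "B x (y + z) = B x y + B x z"
    and scale_right: "B x (scale c y) = cnj c * B x y"
    and nonneg: "0 \<le> B x x"
begin

lemma zero_left [simp]: "B 0 y = 0"
  using add_left[of 0 0 y] by simp

lemma zero_right [simp]: "B x 0 = 0"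
  using add_right[of x 0 0] by simp

lemma diff_left: "B (x - y) z = B x z - B y z"
  using add_left[of "x - y" y z] by simp

lemma sum_left: "B (sum f A) y = (\<Sum>i\<in>A. B (f i) y)"
  by (induction A rule: infinite_finite_induct) (auto simp: add_left)

lemma sum_right: "B x (sum f A) = (\<Sum>i\<in>A. B x (f i))"
  by (induction A rule: infinite_finite_induct) (auto simp: add_right)

lemma self_Im [simp]: "Im (B x x) = 0" and self_Re: "0 \<le> Re (B x x)"
  using nonneg[of x] by (auto simp: less_eq_complex_def)

text \<open>Over the complex numbers positivity forces Hermitian symmetry: the forms at \<open>x + y\<close> and at
  \<open>x + \<i> y\<close> are real (polarization).\<close>

lemma commute: "B y x = cnj (B x y)"
proof -
  have "Im (B (x + y) (x + y)) = 0" and "Im (B (x + scale \<i> y) (x + scale \<i> y)) = 0"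
    by simp_all
  then show ?thesis
    by (simp add: add_left add_right scale_left scale_right complex_eq_iff)
qed

text \<open>The degenerate case of the Cauchy--Schwarz inequality: otherwise \<open>y\<close> plus a large suitable
  multiple of \<open>r\<close> would have negative square.\<close>

lemma null_left:
  assumes "B r r = 0"
  shows "B r y = 0"
proof (rule ccontr)
  define b where "b = B r y"
  assume "B r y \<noteq> 0"
  then have pos: "(cmod b)\<^sup>2 > 0"
    by (simp add: b_def)
  define K where "K = (Re (B y y) + 1) / (cmod b)\<^sup>2"
  define c where "c = - of_real K * cnj b"
  have bb: "b * cnj b = of_real ((cmod b)\<^sup>2)"
    by (simp only: complex_norm_square)
  have "B (y + scale c r) (y + scale c r) = B y y + c * b + cnj (c * b)"
    using assms commute[of r y] by (simp add: add_left add_right scale_left scale_right b_def)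
  also have "c * b = - of_real (K * (cmod b)\<^sup>2)"
    using bb by (simp add: c_def mult.assoc mult.commute)
  finally have "Re (B (y + scale c r) (y + scale c r)) = Re (B y y) - 2 * (K * (cmod b)\<^sup>2)"
    by simp
  also have "K * (cmod b)\<^sup>2 = Re (B y y) + 1"
    using pos by (simp add: K_def)
  finally show False
    using self_Re[of "y + scale c r"] self_Re[of y] by simp
qed

text \<open>Gram--Schmidt for a possibly degenerate form. The Parseval identity allows \<open>y\<close> to range over
  the whole space, not only over the span: the remainder of \<open>x\<close> after projection is a null vector,
  hence orthogonal to everything. This replaces passing to the quotient by the null space.\<close>

lemma orthonormal_Parseval:
  assumes "finite S"
  shows "\<exists>(n::nat) u. (\<forall>i<n. u i \<in> span S) \<and>
           (\<forall>i<n. \<forall>j<n. B (u i) (u j) = (if i = j then 1 else 0)) \<and>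
           (\<forall>x\<in>span S. \<forall>y. B x y = (\<Sum>i<n. B x (u i) * B (u i) y))"
proof -
  have "\<exists>(n::nat) u. (\<forall>i<n. u i \<in> span S) \<and>
           (\<forall>i<n. \<forall>j<n. B (u i) (u j) = (if i = j then 1 else 0)) \<and>
           (\<forall>x\<in>S. \<forall>y. B x y = (\<Sum>i<n. B x (u i) * B (u i) y))"
    using assms
  proof (induction S)
    case empty
    show ?case
      by (rule exI[of _ 0]) simp
  next
    case (insert x S)
    from insert.IH obtain n :: nat and u where nu: "(\<forall>i<n. u i \<in> span S) \<and>
        (\<forall>i<n. \<forall>j<n. B (u i) (u j) = (if i = j then 1 else 0)) \<and>
        (\<forall>x\<in>S. \<forall>y. B x y = (\<Sum>i<n. B x (u i) * B (u i) y))"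
      by (elim exE)
    then have span: "\<And>i. i < n \<Longrightarrow> u i \<in> span S"
      and orth: "\<And>i j. \<lbrakk>i < n; j < n\<rbrakk> \<Longrightarrow> B (u i) (u j) = (if i = j then 1 else 0)"
      by auto
    from nu have Pars: "\<And>z y. z \<in> S \<Longrightarrow> B z y = (\<Sum>i<n. B z (u i) * B (u i) y)"
      by blast
    define r where "r = x - (\<Sum>i<n. scale (B x (u i)) (u i))"
    have span': "i < n \<Longrightarrow> u i \<in> span (insert x S)" for i
      using span span_mono[of S "insert x S"] by blast
    have r_left: "B r y = B x y - (\<Sum>i<n. B x (u i) * B (u i) y)" for y
      by (simp add: r_def diff_left sum_left scale_left)
    have r_u: "B r (u j) = 0" if "j < n" for j
      using that by (simp add: r_left orth if_distrib[of "\<lambda>t. _ * t"] cong: if_cong)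
    have r_span: "r \<in> span (insert x S)"
      unfolding r_def by (intro span_diff span_sum span_scale span' span_base) auto
    show ?case
    proof (cases "B r r = 0")
      case True
      then have "B x y = (\<Sum>i<n. B x (u i) * B (u i) y)" for y
        using null_left[of r y] r_left[of y] by simp
      then show ?thesis
        using span' orth Pars by (intro exI[of _ n] exI[of _ u]) blast
    next
      case False
      define s where "s = sqrt (Re (B r r))"
      have rr: "B r r = of_real (Re (B r r))"
        by (simp add: complex_eq_iff)
      with False have "Re (B r r) > 0"
        using self_Re[of r] by (metis less_eq_real_def of_real_0)
      then have s: "s > 0" and ss: "of_real s * of_real s = B r r"
        using rr by (auto simp: s_def simp flip: of_real_mult)
      define w where "w = scale (1 / of_real s) r"
      have r_w: "B r y = of_real s * B w y" for y
        using s by (simp add: w_def scale_left)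
      have w_u: "B w (u j) = 0" if "j < n" for j
        using that r_u by (simp add: w_def scale_left)
      have u_w: "B (u j) w = 0" if "j < n" for j
        using w_u[OF that] commute[of "u j" w] by simp
      have ww: "B w w = 1"
        using s by (simp add: w_def scale_left scale_right flip: ss)
      have x_w: "B x w = of_real s"
        using r_left[of w] r_w[of w] by (simp add: u_w ww)
      define v where "v = u(n := w)"
      have "(\<Sum>i<Suc n. B z (v i) * B (v i) y) =
          (\<Sum>i<n. B z (u i) * B (u i) y) + B z w * B w y" for z y
        by (simp add: v_def)
      moreover have "B z w = 0" if "z \<in> S" for z
        using Pars[OF that, of w] by (simp add: u_w)
      ultimately have "B z y = (\<Sum>i<Suc n. B z (v i) * B (v i) y)" if "z \<in> insert x S" for z y
        using that Pars[of z y] r_left[of y] r_w[of y] x_w by (elim insertE) simp_all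
      moreover have "v i \<in> span (insert x S)" if "i < Suc n" for i
        using that r_span span' by (auto simp: v_def w_def less_Suc_eq intro: span_scale)
      moreover have "B (v i) (v j) = (if i = j then 1 else 0)" if "i < Suc n" "j < Suc n" for i j
        using that by (auto simp: v_def less_Suc_eq orth ww u_w w_u)
      ultimately show ?thesis
        by blast
    qed
  qed
  then obtain n :: nat and u where u: "(\<forall>i<n. u i \<in> span S) \<and>
        (\<forall>i<n. \<forall>j<n. B (u i) (u j) = (if i = j then 1 else 0)) \<and>
        (\<forall>x\<in>S. \<forall>y. B x y = (\<Sum>i<n. B x (u i) * B (u i) y))"
    by (elim exE)
  then have Pars: "\<And>z y. z \<in> S \<Longrightarrow> B z y = (\<Sum>i<n. B z (u i) * B (u i) y)"
    by blast
  have "B x y = (\<Sum>i<n. B x (u i) * B (u i) y)" if "x \<in> span S" for x y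
    using that
  proof (induction rule: span_induct_alt)
    case base
    show ?case by simp
  next
    case (step c x z)
    then show ?case
      using Pars[of x y]
      by (simp add: add_left scale_left distrib_right sum.distrib sum_distrib_left mult.assoc)
  qed
  with u show ?thesis
    by blast
qed

text \<open>If \<open>X\<close> is symmetric on the span of \<open>S\<close> but leads out of it, then the matrix entries
  \<open>B (X u\<^sub>j) u\<^sub>i\<close> represent \<open>X\<close> followed by the orthogonal projection onto the span; here
  \<open>i \<mapsto> B t u\<^sub>i\<close> are the coordinates of the projection of \<open>t\<close>.\<close>

lemma compression_matrix:
  fixes n :: nat
  assumes span: "\<And>i. i < n \<Longrightarrow> u i \<in> span S"
    and Pars: "\<And>x y. x \<in> span S \<Longrightarrow> B x y = (\<Sum>i<n. B x (u i) * B (u i) y)"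
    and sym: "\<And>x y. \<lbrakk>x \<in> span S; y \<in> span S\<rbrakk> \<Longrightarrow> B (X x) y = B x (X y)"
  defines "M \<equiv> mat n n (\<lambda>(i, j). B (X (u j)) (u i))"
  shows "self_adjoint_on n M"
    and "t \<in> span S \<Longrightarrow> M *\<^sub>v vec n (\<lambda>i. B t (u i)) = vec n (\<lambda>i. B (X t) (u i))"
proof -
  have herm: "M $$ (i, j) = cnj (M $$ (j, i))" if "i < n" "j < n" for i j
    using that sym[of "u j" "u i"] span commute[of "u j" "X (u i)"] by (simp add: M_def)
  have dim: "M \<in> carrier_mat n n"
    by (simp add: M_def)
  show "self_adjoint_on n M"
    unfolding self_adjoint_on_def
  proof (intro conjI ballI dim)
    fix x y :: "complex vec"
    assume xy: "x \<in> carrier_vec n" "y \<in> carrier_vec n"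
    have entry: "M $$ (i, j) * x $ j * cnj (y $ i) = x $ j * cnj (M $$ (j, i) * y $ i)"
      if "i < n" "j < n" for i j
      by (subst herm[OF that]) (simp add: mult_ac)
    have "(M *\<^sub>v x) \<bullet>c y = (\<Sum>i<n. \<Sum>j<n. M $$ (i, j) * x $ j * cnj (y $ i))"
      using xy dim by (simp add: scalar_prod_def atLeast0LessThan sum_distrib_right)
    also have "\<dots> = (\<Sum>j<n. \<Sum>i<n. x $ j * cnj (M $$ (j, i) * y $ i))"
      by (subst sum.swap) (intro sum.cong refl, simp add: entry)
    also have "\<dots> = x \<bullet>c (M *\<^sub>v y)"
      using xy dim by (simp add: scalar_prod_def atLeast0LessThan sum_distrib_left)
    finally show "(M *\<^sub>v x) \<bullet>c y = x \<bullet>c (M *\<^sub>v y)" .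
  qed
  show "M *\<^sub>v vec n (\<lambda>i. B t (u i)) = vec n (\<lambda>i. B (X t) (u i))" if t: "t \<in> span S"
  proof (rule eq_vecI)
    fix i assume "i < dim_vec (vec n (\<lambda>i. B (X t) (u i)))"
    then have i: "i < n" by simp
    have "(M *\<^sub>v vec n (\<lambda>i. B t (u i))) $ i = (\<Sum>j<n. B (X (u j)) (u i) * B t (u j))"
      using i by (simp add: M_def scalar_prod_def atLeast0LessThan)
    \<comment> \<open>Parseval needs its left argument \<open>t\<close> in the span; \<open>X (u i)\<close> may lie outside.\<close>
    also have "\<dots> = (\<Sum>j<n. B t (u j) * B (u j) (X (u i)))"
      using i span sym by (intro sum.cong) auto
    also have "\<dots> = B (X t) (u i)"
      using Pars[OF t, of "X (u i)"] sym[OF t span[OF i]] by simp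
    finally show "(M *\<^sub>v vec n (\<lambda>i. B t (u i))) $ i = vec n (\<lambda>i. B (X t) (u i)) $ i"
      using i by simp
  qed (simp add: M_def)
qed

end

section \<open>Riesz representation and adjoints\<close>

interpretation hilbert: positive_form scaleC "cinner :: 'h::complex_hilbert \<Rightarrow> 'h \<Rightarrow> complex"
proof
  fix x y z :: 'h and c :: complex
  show "1 *\<^sub>C x = x"
    using scaleR_scaleC[of 1 x] by simp
  show "cinner x (y + z) = cinner x y + cinner x z"
    by (metis cinner_commute cinner_add_left complex_cnj_add)
  show "cinner x (c *\<^sub>C y) = cnj c * cinner x y"
    by (metis cinner_commute cinner_scaleC_left complex_cnj_mult)
  show "0 \<le> cinner x x"
    by (simp add: cinner_self less_eq_complex_def)
qed (rule scaleC_add_right scaleC_add_left scaleC_scaleC cinner_add_left cinner_scaleC_left)+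

lemma norm_add_sq:
  fixes x y :: "'h::complex_hilbert"
  shows "(norm (x + y))\<^sup>2 = (norm x)\<^sup>2 + (norm y)\<^sup>2 + 2 * Re (cinner x y)"
proof -
  have "Re (cinner (x + y) (x + y)) = Re (cinner x x) + Re (cinner y y) + 2 * Re (cinner x y)"
    using cinner_commute[of y x] by (simp add: hilbert.add_left hilbert.add_right)
  then show ?thesis
    by (simp only: cinner_self Re_complex_of_real)
qed

lemma norm_scaleC: "norm (c *\<^sub>C x) = cmod c * norm (x :: 'h::complex_hilbert)"
proof -
  have "complex_of_real ((norm (c *\<^sub>C x))\<^sup>2) = (c * cnj c) * complex_of_real ((norm x)\<^sup>2)"
    by (simp only: hilbert.scale_left hilbert.scale_right flip: cinner_self) (simp add: mult.assoc)
  also have "\<dots> = complex_of_real ((cmod c * norm x)\<^sup>2)"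
    by (simp only: power_mult_distrib of_real_mult complex_norm_square)
  finally have "(norm (c *\<^sub>C x))\<^sup>2 = (cmod c * norm x)\<^sup>2"
    by (simp only: of_real_eq_iff)
  then show ?thesis
    by (simp add: power2_eq_iff_nonneg)
qed

lemma cinner_bound: "cmod (cinner x y) \<le> norm x * norm (y :: 'h::complex_hilbert)"
proof (cases "y = 0")
  case False
  define c where "c = - (cinner x y / of_real ((norm y)\<^sup>2))"
  have "0 \<le> (norm (x + c *\<^sub>C y))\<^sup>2"
    by simp
  also have "\<dots> = (norm x)\<^sup>2 + (cmod c * norm y)\<^sup>2 + 2 * Re (cnj c * cinner x y)"
    by (simp add: norm_add_sq norm_scaleC hilbert.scale_right)
  also have "cnj c * cinner x y = - of_real ((cmod (cinner x y))\<^sup>2 / (norm y)\<^sup>2)"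
    using complex_norm_square[of "cinner x y"] by (simp add: c_def mult.commute)
  also have "(cmod c * norm y)\<^sup>2 = (cmod (cinner x y))\<^sup>2 / (norm y)\<^sup>2"
    using False by (simp add: c_def norm_divide norm_power power_mult_distrib power_divide)
      (simp add: power2_eq_square power4_eq_xxxx)
  finally have "(cmod (cinner x y))\<^sup>2 / (norm y)\<^sup>2 \<le> (norm x)\<^sup>2"
    by simp
  then have "(cmod (cinner x y))\<^sup>2 \<le> (norm x * norm y)\<^sup>2"
    using False by (simp add: divide_simps power_mult_distrib)
  then show ?thesis
    by (rule power2_le_imp_le) simp
qed simp

text \<open>The representing vector minimizes \<open>J x = \<parallel>x\<parallel>\<^sup>2 - 2 Re (f x)\<close>: by the parallelogram law minimizing
  sequences are Cauchy, and the vanishing first variation of \<open>J\<close> at the minimum is the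
  representation of \<open>Re f\<close>.\<close>

lemma Riesz:
  fixes f :: "'h::complex_hilbert \<Rightarrow> complex"
  assumes lin: "bounded_linear f" and clin: "\<And>c x. f (c *\<^sub>C x) = c * f x"
  shows "\<exists>z. \<forall>x. f x = cinner x z"
proof -
  interpret f: bounded_linear f by (rule lin)
  define J where "J x = (norm x)\<^sup>2 - 2 * Re (f x)" for x
  obtain K where K: "\<And>x. norm (f x) \<le> norm x * K"
    using f.bounded by blast
  have "- K\<^sup>2 \<le> J x" for x
  proof -
    have "Re (f x) \<le> norm x * K"
      using complex_Re_le_cmod[of "f x"] K[of x] by linarith
    moreover have "0 \<le> (norm x - K)\<^sup>2"
      by simp
    ultimately show ?thesis
      unfolding J_def power2_diff by linarith
  qed
  then have bdd: "bdd_below (range J)"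
    by (intro bdd_belowI2[of UNIV]) auto
  define m where "m = Inf (range J)"
  have m_le: "m \<le> J x" for x
    unfolding m_def using bdd by (intro cINF_lower) auto
  have "\<exists>x. J x < m + 1 / real (Suc n)" for n
    using cInf_lessD[of "range J" "m + 1 / real (Suc n)"] by (auto simp: m_def)
  then obtain X where X: "\<And>n. J (X n) < m + 1 / real (Suc n)"
    by metis
  have diff: "(norm (x - y))\<^sup>2 \<le> 2 * J x + 2 * J y - 4 * m" for x y
  proof -
    have "cinner x y + cinner x (- y) = 0"
      using hilbert.add_right[of x y "- y"] by simp
    then have "Re (cinner x y) + Re (cinner x (- y)) = 0"
      by (metis plus_complex.sel(1) zero_complex.sel(1))
    then have "(norm (x - y))\<^sup>2 + (norm (x + y))\<^sup>2 = 2 * (norm x)\<^sup>2 + 2 * (norm y)\<^sup>2"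
      using norm_add_sq[of x y] norm_add_sq[of x "- y"] by simp
    moreover have "4 * J ((1/2) *\<^sub>R (x + y)) = (norm (x + y))\<^sup>2 - 4 * Re (f x) - 4 * Re (f y)"
      unfolding J_def f.scaleR f.add norm_scaleR by (simp add: power_divide) (simp add: field_simps)
    ultimately show ?thesis
      using m_le[of "(1/2) *\<^sub>R (x + y)"] unfolding J_def by argo
  qed
  have "Cauchy X"
  proof (rule metric_CauchyI)
    fix e :: real assume "e > 0"
    then obtain N where N: "inverse (real (Suc N)) < e\<^sup>2 / 4"
      using reals_Archimedean[of "e\<^sup>2 / 4"] by auto
    have small: "J (X i) < m + e\<^sup>2 / 4" if "i \<ge> N" for i
    proof -
      have "1 / real (Suc i) \<le> inverse (real (Suc N))"
        using that by (simp add: divide_simps)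
      then show ?thesis
        using X[of i] N by linarith
    qed
    have "dist (X i) (X j) < e" if "i \<ge> N" "j \<ge> N" for i j
    proof -
      have "(norm (X i - X j))\<^sup>2 < e\<^sup>2"
        using diff[of "X i" "X j"] small[OF that(1)] small[OF that(2)] by argo
      then show ?thesis
        using \<open>e > 0\<close> by (auto simp: dist_norm intro: power2_less_imp_less)
    qed
    then show "\<exists>M. \<forall>i\<ge>M. \<forall>j\<ge>M. dist (X i) (X j) < e"
      by blast
  qed
  then obtain z where z: "X \<longlonglongrightarrow> z"
    using Cauchy_convergent_iff convergent_def by blast
  have "(\<lambda>n. J (X n)) \<longlonglongrightarrow> J z"
    unfolding J_def by (intro tendsto_intros f.tendsto z)
  moreover have "(\<lambda>n. m + 1 / real (Suc n)) \<longlonglongrightarrow> m + 0"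
    using LIMSEQ_inverse_real_of_nat by (intro tendsto_add tendsto_const) (simp add: inverse_eq_divide)
  ultimately have "J z \<le> m + 0"
    by (rule LIMSEQ_le) (use X in \<open>auto intro: less_imp_le\<close>)
  then have min: "J z \<le> J x" for x
    using m_le[of x] by simp
  have Re_eq: "Re (f x) = Re (cinner z x)" for x
  proof -
    define D where "D = Re (cinner z x) - Re (f x)"
    define q where "q = (norm x)\<^sup>2"
    \<comment> \<open>A step against the sign of the first variation \<open>2 t D\<close>, short enough that \<open>t\<^sup>2 q\<close> cannot
      compensate; \<open>q + 1\<close> avoids the case \<open>q = 0\<close>.\<close>
    define t where "t = - D / (q + 1)"
    have q: "q \<ge> 0"
      by (simp add: q_def)
    have "J (z + t *\<^sub>R x) = J z + 2 * t * D + t\<^sup>2 * q"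
      unfolding J_def norm_add_sq f.add f.scaleR
      by (simp add: scaleR_scaleC[of t x] hilbert.scale_right norm_scaleC D_def q_def power_mult_distrib
          algebra_simps)
    then have "0 \<le> 2 * t * D + t\<^sup>2 * q"
      using min[of "z + t *\<^sub>R x"] by simp
    also have "\<dots> = - (D\<^sup>2 * (q + 2)) / (q + 1)\<^sup>2"
      using q unfolding t_def by (simp add: divide_simps power2_eq_square) (simp add: algebra_simps)
    finally have "D\<^sup>2 * (q + 2) \<le> 0"
      using q by (simp add: divide_simps)
    then have "D = 0"
      using q by (simp add: mult_le_0_iff)
    then show ?thesis
      by (simp add: D_def)
  qed
  have "f x = cinner x z" for x
    using Re_eq[of x] Re_eq[of "\<i> *\<^sub>C x"] cinner_commute[of x z]
    by (simp add: clin hilbert.scale_right complex_eq_iff)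
  then show ?thesis
    by blast
qed

lemma bounded_clinearI:
  assumes "\<And>x y. A (x + y) = A x + A y" "\<And>c x. A (c *\<^sub>C x) = c *\<^sub>C A x"
    and "\<And>x. norm (A x) \<le> norm x * K"
  shows "bounded_clinear A"
  unfolding bounded_clinear_def
  using assms by (auto intro!: bounded_linear_intro[of _ K] simp: scaleR_scaleC)

lemma bounded_clinearD:
  assumes "bounded_clinear A"
  shows "A (x + y) = A x + A y" "A (c *\<^sub>C x) = c *\<^sub>C A x" "A (sum h S) = (\<Sum>i\<in>S. A (h i))"
    "A 0 = 0" "\<exists>K. \<forall>x. norm (A x) \<le> norm x * K"
proof -
  interpret bounded_linear A
    using assms by (simp add: bounded_clinear_def)
  show "A (x + y) = A x + A y" "A (sum h S) = (\<Sum>i\<in>S. A (h i))" "A 0 = 0"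
    by (auto simp: add sum zero)
  show "A (c *\<^sub>C x) = c *\<^sub>C A x"
    using assms by (simp add: bounded_clinear_def)
  show "\<exists>K. \<forall>x. norm (A x) \<le> norm x * K"
    using bounded by blast
qed

text \<open>The involution on polynomials uses adjoints of arbitrary bounded coefficients, so
  \<open>cadjoint\<close>, a definite description, has to be shown to denote.\<close>

lemma cadjoint_exists:
  assumes A: "bounded_clinear (A :: 'h::complex_hilbert \<Rightarrow> 'h)"
  shows "\<exists>C. bounded_clinear C \<and> (\<forall>x y. cinner (A x) y = cinner x (C y))"
proof -
  obtain K where K: "\<And>x. norm (A x) \<le> norm x * K"
    using bounded_clinearD(5)[OF A] by blast
  have "\<exists>z. \<forall>x. cinner (A x) y = cinner x z" for y
  proof (rule Riesz)
    show "bounded_linear (\<lambda>x. cinner (A x) y)"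
    proof (rule bounded_linear_intro[of _ "K * norm y"])
      show "norm (cinner (A x) y) \<le> norm x * (K * norm y)" for x
        using cinner_bound[of "A x" y] mult_right_mono[OF K[of x], of "norm y"]
        by (simp add: mult.assoc)
    qed (simp_all add: bounded_clinearD[OF A] hilbert.add_left hilbert.scale_left scaleR_scaleC
        scaleC_complex_def)
    show "cinner (A (c *\<^sub>C x)) y = c * cinner (A x) y" for c x
      by (simp add: bounded_clinearD[OF A] hilbert.scale_left)
  qed
  then obtain C where C: "\<And>x y. cinner (A x) y = cinner x (C y)"
    by metis
  have "bounded_clinear C"
  proof (rule bounded_clinearI)
    show "C (x + y) = C x + C y" for x y
      by (rule cinner_ext) (simp add: hilbert.add_right flip: C)
    show "C (c *\<^sub>C x) = c *\<^sub>C C x" for c x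
      by (rule cinner_ext) (simp add: hilbert.scale_right flip: C)
    show "norm (C y) \<le> norm y * K" for y
    proof (cases "C y = 0")
      case True
      have "0 \<le> K * norm y"
        using order_trans[OF norm_ge_zero K[of y]] by (simp add: mult.commute)
      then show ?thesis
        using True by (simp add: mult.commute)
    next
      case False
      have "(norm (C y))\<^sup>2 = cmod (cinner (A (C y)) y)"
        by (simp add: C cinner_self norm_power)
      also have "\<dots> \<le> norm (A (C y)) * norm y"
        by (rule cinner_bound)
      also have "\<dots> \<le> norm (C y) * K * norm y"
        by (intro mult_right_mono K) simp
      finally show ?thesis
        using False by (simp add: power2_eq_square mult_ac)
    qed
  qed
  with C show ?thesis
    by blast
qed

lemma bounded_clinear_cadjoint: "bounded_clinear A \<Longrightarrow> bounded_clinear (cadjoint A)"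
  and cinner_cadjoint: "bounded_clinear A \<Longrightarrow> cinner (cadjoint A x) y = cinner x (A y)"
  and cinner_cadjoint_right: "bounded_clinear A \<Longrightarrow> cinner x (cadjoint A y) = cinner (A x) y"
proof -
  assume "bounded_clinear A"
  from cadjoint_exists[OF this] obtain C
    where C: "bounded_clinear C" "\<And>x y. cinner (A x) y = cinner x (C y)"
    by blast
  then have "cadjoint A = C"
    by (intro cadjoint_eqI)
  with C show "bounded_clinear (cadjoint A)" "cinner x (cadjoint A y) = cinner (A x) y"
    by simp_all
  then show "cinner (cadjoint A x) y = cinner x (A y)"
    using \<open>cadjoint A = C\<close> C(2)[of y x] hilbert.commute[of x "A y"] hilbert.commute[of "cadjoint A x" y]
    by simp
qed

section \<open>Polynomials with operator coefficients\<close>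

lemma bounded_clinear_zero [simp]: "bounded_clinear (\<lambda>_. 0 :: 'h::complex_hilbert)"
  by (rule bounded_clinearI[of _ 0]) simp_all

lemma bounded_clinear_add:
  assumes "bounded_clinear A" "bounded_clinear C"
  shows "bounded_clinear (\<lambda>x. A x + C x)"
  using assms by (auto simp: bounded_clinear_def bounded_linear_add hilbert.scale_right_distrib)

lemma bounded_clinear_scale:
  assumes A: "bounded_clinear A"
  shows "bounded_clinear (\<lambda>x. c *\<^sub>C A x)"
proof -
  obtain K where K: "\<And>x. norm (A x) \<le> norm x * K"
    using bounded_clinearD(5)[OF A] by blast
  show ?thesis
  proof (rule bounded_clinearI)
    show "norm (c *\<^sub>C A x) \<le> norm x * (cmod c * K)" for x
      using mult_left_mono[OF K[of x], of "cmod c"] by (simp add: norm_scaleC mult_ac)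
  qed (simp_all add: bounded_clinearD[OF A] hilbert.scale_right_distrib mult.commute)
qed

lemma bounded_clinear_sum:
  assumes "\<And>i. i \<in> I \<Longrightarrow> bounded_clinear (A i)"
  shows "bounded_clinear (\<lambda>x. \<Sum>i\<in>I. A i x)"
  using assms by (induction I rule: infinite_finite_induct) (auto intro: bounded_clinear_add)

lemma bounded_clinear_comp:
  assumes "bounded_clinear A" "bounded_clinear C"
  shows "bounded_clinear (\<lambda>x. A (C x))"
  using assms by (auto simp: bounded_clinear_def intro: bounded_linear_compose)

lemma bounded_clinear_rank_one: "bounded_clinear (\<lambda>x. cinner x e *\<^sub>C f)"
proof (rule bounded_clinearI)
  show "norm (cinner x e *\<^sub>C f) \<le> norm x * (norm e * norm f)" for x
    using mult_right_mono[OF cinner_bound[of x e], of "norm f"] by (simp add: norm_scaleC mult.assoc)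
qed (simp_all add: hilbert.add_left hilbert.scale_left hilbert.scale_left_distrib)

lemma cadjoint_zero: "cadjoint (\<lambda>_. 0) = (\<lambda>_. 0 :: 'h::complex_hilbert)"
  by (rule cadjoint_eqI) simp_all

lemma finite_words_le [simp]: "finite (words_le g k)"
  unfolding words_le_def using finite_lists_length_le[of "{..<g}" k] by simp

lemma words_le_mono: "k \<le> l \<Longrightarrow> words_le g k \<subseteq> words_le g l"
  by (auto simp: words_le_def)

lemma ncpolys_leI:
  assumes "\<And>w. w \<in> words_le g k \<Longrightarrow> bounded_clinear (p w)"
    and "\<And>w. w \<notin> words_le g k \<Longrightarrow> p w = (\<lambda>_. 0)"
  shows "p \<in> ncpolys_le g k"
proof -
  have "bounded_clinear (p w)" for w
    using assms[of w] by (cases "w \<in> words_le g k") simp_all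
  then show ?thesis
    using assms(2) by (auto simp: ncpolys_le_iff nc_support_def)
qed

lemma ncpolys_leD:
  assumes "p \<in> ncpolys_le g k"
  shows "bounded_clinear (p w)" "w \<notin> words_le g k \<Longrightarrow> p w = (\<lambda>_. 0)"
  using assms by (auto simp: ncpolys_le_iff nc_support_def)

lemma ncpolys_le_mono: "k \<le> l \<Longrightarrow> ncpolys_le g k \<subseteq> ncpolys_le g l"
  using words_le_mono[of k l g] unfolding ncpolys_le_iff subset_iff by blast

lemma nc_add_closed:
  "\<lbrakk>p \<in> ncpolys_le g k; q \<in> ncpolys_le g k\<rbrakk> \<Longrightarrow> nc_add p q \<in> ncpolys_le g k"
  by (rule ncpolys_leI) (auto simp: nc_add_def ncpolys_leD(2) intro: bounded_clinear_add ncpolys_leD(1))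

lemma nc_scale_closed: "p \<in> ncpolys_le g k \<Longrightarrow> nc_scale c p \<in> ncpolys_le g k"
  by (rule ncpolys_leI) (auto simp: nc_scale_def ncpolys_leD(2) intro: bounded_clinear_scale ncpolys_leD(1))

lemma nc_sum_closed:
  assumes "\<And>i. i \<in> I \<Longrightarrow> p i \<in> ncpolys_le g k"
  shows "(\<lambda>w x. \<Sum>i\<in>I. p i w x) \<in> ncpolys_le g k"
  by (rule ncpolys_leI)
    (use ncpolys_leD(1)[OF assms] ncpolys_leD(2)[OF assms] in \<open>auto intro!: bounded_clinear_sum\<close>)

lemma take_drop_words_le:
  assumes "rev (take i w) \<in> words_le g k" "drop i w \<in> words_le g l"
  shows "w \<in> words_le g (k + l)"
proof -
  have "rev (rev (take i w)) @ drop i w \<in> words_le g (k + l)"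
    using assms unfolding words_le_def mem_Collect_eq set_append set_rev length_append length_rev
    by (intro conjI Un_least add_mono) blast+
  then show ?thesis
    by simp
qed

lemma nc_star_mult_closed:
  assumes q: "q \<in> ncpolys_le g k" and p: "p \<in> ncpolys_le g l"
  shows "nc_mult (nc_star q) p \<in> ncpolys_le g (k + l)"
proof (rule ncpolys_leI)
  show "bounded_clinear (nc_mult (nc_star q) p w)" for w
    unfolding nc_mult_def nc_star_def
    by (rule bounded_clinear_sum, rule bounded_clinear_comp)
      (intro bounded_clinear_cadjoint ncpolys_leD(1)[OF p] ncpolys_leD(1)[OF q])+
  show "nc_mult (nc_star q) p w = (\<lambda>_. 0)" if w: "w \<notin> words_le g (k + l)" for w
  proof -
    have "cadjoint (q (rev (take i w))) (p (drop i w) x) = 0" for i x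
    proof (cases "rev (take i w) \<in> words_le g k")
      case True
      then have "drop i w \<notin> words_le g l"
        using take_drop_words_le w by blast
      then show ?thesis
        using ncpolys_leD(2)[OF p] bounded_clinearD(4)[OF bounded_clinear_cadjoint[OF ncpolys_leD(1)[OF q]]]
        by simp
    next
      case False
      then show ?thesis
        using ncpolys_leD(2)[OF q] by (simp add: cadjoint_zero)
    qed
    then show ?thesis
      by (simp add: nc_mult_def nc_star_def)
  qed
qed

lemma nc_linear_functional_sum:
  assumes lin: "nc_linear_functional g k \<phi>" and "finite I"
    and p: "\<And>i. i \<in> I \<Longrightarrow> p i \<in> ncpolys_le g k"
  shows "\<phi> (\<lambda>w x. \<Sum>i\<in>I. c i *\<^sub>C p i w x) = (\<Sum>i\<in>I. c i * \<phi> (p i))"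
  using \<open>finite I\<close> p
proof (induction I)
  case empty
  have "(\<lambda>w x. 0) \<in> ncpolys_le g k"
    by (rule ncpolys_leI) simp_all
  then have "\<phi> (nc_scale 0 (\<lambda>w x. 0)) = 0 * \<phi> (\<lambda>w x. 0)"
    using lin unfolding nc_linear_functional_def by blast
  then show ?case
    by (simp add: nc_scale_def)
next
  case (insert j I)
  let ?s = "\<lambda>w x. \<Sum>i\<in>I. c i *\<^sub>C p i w x"
  have "?s = (\<lambda>w x. \<Sum>i\<in>I. nc_scale (c i) (p i) w x)"
    by (simp add: nc_scale_def)
  then have s: "?s \<in> ncpolys_le g k"
    using insert.prems by (auto intro!: nc_sum_closed nc_scale_closed)
  have "(\<lambda>w x. \<Sum>i\<in>insert j I. c i *\<^sub>C p i w x) = nc_add (nc_scale (c j) (p j)) ?s"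
    using insert.hyps by (simp add: nc_add_def nc_scale_def)
  moreover have "\<phi> (nc_add (nc_scale (c j) (p j)) ?s) = \<phi> (nc_scale (c j) (p j)) + \<phi> ?s"
    "\<phi> (nc_scale (c j) (p j)) = c j * \<phi> (p j)"
    using lin s insert.prems nc_scale_closed unfolding nc_linear_functional_def by blast+
  ultimately show ?case
    using insert by simp
qed

section \<open>Functionals continuous in the weak operator topology\<close>

text \<open>Membership in a subbasic set depends on a single entry \<open>\<langle>C x, y\<rangle>\<close>, and every point of \<open>U\<close>
  lies in a finite intersection of such sets inside \<open>U\<close>. Exact agreement of entries, rather than
  proximity, is what is needed later: the lemma serves to find operators on which a linear functional vanishes.\<close>

lemma openin_wot_finite:
  assumes "openin wot U" "A \<in> U"
  shows "\<exists>F. finite F \<and> (\<forall>C. bounded_clinear C \<longrightarrow>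
           (\<forall>(x, y)\<in>F. cinner (C x) y = cinner (A x) y) \<longrightarrow> C \<in> U)"
proof -
  have "generate_topology_on {{A. bounded_clinear A \<and> cinner (A x) y \<in> U} | x y U. open U} U"
    using assms(1) unfolding wot_def openin_topology_generated_by_iff .
  then show ?thesis
    using assms(2)
  proof (induction U)
    case (Int a b)
    then obtain F G where "finite F" "finite G"
      and F: "\<forall>C. bounded_clinear C \<longrightarrow> (\<forall>(x, y)\<in>F. cinner (C x) y = cinner (A x) y) \<longrightarrow> C \<in> a"
      and G: "\<forall>C. bounded_clinear C \<longrightarrow> (\<forall>(x, y)\<in>G. cinner (C x) y = cinner (A x) y) \<longrightarrow> C \<in> b"
      by blast
    then show ?case
      by (intro exI[of _ "F \<union> G"]) blast
  next
    case (UN K)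
    then obtain a where "a \<in> K" "A \<in> a"
      by blast
    with UN.IH[OF this] show ?case
      by blast
  next
    case (Basis s)
    then obtain x y V where s: "s = {A. bounded_clinear A \<and> cinner (A x) y \<in> V}"
      by blast
    with Basis.prems show ?case
      by (intro exI[of _ "{(x, y)}"]) auto
  qed simp
qed

lemma openin_nc_product_wot_finite:
  assumes "openin (nc_product_wot g k) U" "p \<in> U"
  shows "\<exists>F. finite F \<and> (\<forall>q\<in>ncpolys_le g k.
           (\<forall>w\<in>words_le g k. \<forall>(x, y)\<in>F. cinner (q w x) y = cinner (p w x) y) \<longrightarrow> q \<in> U)"
proof -
  let ?W = "words_le g k"
  obtain V where V: "openin (product_topology (\<lambda>_. wot) ?W) V"
    and U: "U = (\<lambda>p. restrict p ?W) -` V \<inter> ncpolys_le g k"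
    using assms(1) unfolding nc_product_wot_def openin_pullback_topology by blast
  have "restrict p ?W \<in> V"
    using assms(2) U by blast
  moreover have "\<forall>x\<in>V. \<exists>N. finite {w \<in> ?W. N w \<noteq> topspace wot} \<and> (\<forall>w\<in>?W. openin wot (N w)) \<and>
      x \<in> Pi\<^sub>E ?W N \<and> Pi\<^sub>E ?W N \<subseteq> V"
    using V unfolding openin_product_topology_alt .
  ultimately have "\<exists>N. finite {w \<in> ?W. N w \<noteq> topspace wot} \<and> (\<forall>w\<in>?W. openin wot (N w)) \<and>
      restrict p ?W \<in> Pi\<^sub>E ?W N \<and> Pi\<^sub>E ?W N \<subseteq> V"
    by (rule bspec[rotated])
  then obtain N where N: "\<And>w. w \<in> ?W \<Longrightarrow> openin wot (N w)"
    and pN: "restrict p ?W \<in> Pi\<^sub>E ?W N" and NV: "Pi\<^sub>E ?W N \<subseteq> V"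
    by (elim exE conjE) blast
  have "\<exists>F. finite F \<and> (\<forall>C. bounded_clinear C \<longrightarrow>
           (\<forall>(x, y)\<in>F. cinner (C x) y = cinner (p w x) y) \<longrightarrow> C \<in> N w)" if "w \<in> ?W" for w
    using that N[OF that] pN by (intro openin_wot_finite) (auto simp: PiE_iff)
  then have "\<forall>w\<in>?W. \<exists>F. finite F \<and> (\<forall>C. bounded_clinear C \<longrightarrow>
           (\<forall>(x, y)\<in>F. cinner (C x) y = cinner (p w x) y) \<longrightarrow> C \<in> N w)"
    by (rule ballI)
  from bchoice[OF this] obtain F where Fw: "\<forall>w\<in>?W. finite (F w) \<and> (\<forall>C. bounded_clinear C \<longrightarrow>
           (\<forall>(x, y)\<in>F w. cinner (C x) y = cinner (p w x) y) \<longrightarrow> C \<in> N w)"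
    by (elim exE)
  then have F: "\<And>w. w \<in> ?W \<Longrightarrow> finite (F w)"
    "\<And>w C. \<lbrakk>w \<in> ?W; bounded_clinear C; \<forall>(x, y)\<in>F w. cinner (C x) y = cinner (p w x) y\<rbrakk> \<Longrightarrow> C \<in> N w"
    by simp_all
  show ?thesis
  proof (intro exI[of _ "\<Union>(F ` ?W)"] conjI ballI impI)
    show "finite (\<Union>(F ` ?W))"
      using F(1) by simp
    fix q assume q: "q \<in> ncpolys_le g k"
      and eq: "\<forall>w\<in>?W. \<forall>(x, y)\<in>\<Union>(F ` ?W). cinner (q w x) y = cinner (p w x) y"
    have "q w \<in> N w" if "w \<in> ?W" for w
      using that eq by (intro F(2) ncpolys_leD(1)[OF q]) blast+
    then have "restrict q ?W \<in> V"
      using NV by (intro subsetD[OF NV]) simp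
    with q show "q \<in> U"
      by (simp add: U)
  qed
qed

text \<open>The set \<open>{p. \<phi> p \<noteq> 1}\<close> is a neighbourhood of \<open>0\<close>, so it contains every \<open>p\<close> for which certain
  finitely many entries vanish. These \<open>p\<close> form a subspace, on which a linear functional that
  omits the value \<open>1\<close> is zero.\<close>

lemma wot_continuous_finite_dependence:
  fixes \<phi> :: "'h::complex_hilbert ncpoly \<Rightarrow> complex"
  assumes lin: "nc_linear_functional g k \<phi>"
    and cont: "continuous_map (nc_product_wot g k) euclidean \<phi>"
  shows "\<exists>F. finite F \<and> (\<forall>p\<in>ncpolys_le g k.
           (\<forall>w\<in>words_le g k. \<forall>(x, y)\<in>F. cinner (p w x) y = 0) \<longrightarrow> \<phi> p = 0)"
proof -
  let ?U = "{p \<in> ncpolys_le g k. \<phi> p \<noteq> 1}"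
  have "openin (nc_product_wot g k) ?U"
    using openin_continuous_map_preimage[OF cont, of "- {1}"]
    by (simp add: topspace_nc_product_wot open_Compl)
  moreover have "(\<lambda>w x. 0) \<in> ?U"
  proof -
    have "\<phi> (\<lambda>w x. 0) = 0"
      using nc_linear_functional_sum[OF lin, of "{}"] by simp
    then show ?thesis
      by (auto intro: ncpolys_leI)
  qed
  ultimately have "\<exists>F. finite F \<and> (\<forall>q\<in>ncpolys_le g k.
      (\<forall>w\<in>words_le g k. \<forall>(x, y)\<in>F. cinner (q w x) y = cinner 0 y) \<longrightarrow> q \<in> ?U)"
    by (rule openin_nc_product_wot_finite)
  then obtain F where Ff: "finite F \<and> (\<forall>q\<in>ncpolys_le g k.
      (\<forall>w\<in>words_le g k. \<forall>(x, y)\<in>F. cinner (q w x) y = cinner 0 y) \<longrightarrow> q \<in> ?U)"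
    by (elim exE)
  then have F: "finite F" "\<And>q. \<lbrakk>q \<in> ncpolys_le g k;
      \<forall>w\<in>words_le g k. \<forall>(x, y)\<in>F. cinner (q w x) y = cinner 0 y\<rbrakk> \<Longrightarrow> q \<in> ?U"
    by simp_all
  have "\<phi> p = 0" if p: "p \<in> ncpolys_le g k"
    and vanish: "\<forall>w\<in>words_le g k. \<forall>(x, y)\<in>F. cinner (p w x) y = 0" for p
  proof (rule ccontr)
    assume nz: "\<phi> p \<noteq> 0"
    have "nc_scale (1 / \<phi> p) p \<in> ?U"
      using vanish by (intro F(2) nc_scale_closed p) (auto simp: nc_scale_def hilbert.scale_left)
    moreover have "\<phi> (nc_scale (1 / \<phi> p) p) = 1 / \<phi> p * \<phi> p"
      using lin p unfolding nc_linear_functional_def by blast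
    ultimately show False
      using nz by simp
  qed
  with F(1) show ?thesis
    by blast
qed

definition matrix_unit :: "(nat \<Rightarrow> 'h::complex_hilbert) \<Rightarrow> nat list \<Rightarrow> nat \<Rightarrow> nat \<Rightarrow> 'h ncpoly" where
  "matrix_unit e w a b = (\<lambda>w' x. if w' = w then cinner x (e a) *\<^sub>C e b else 0)"

lemma matrix_unit_closed: "w \<in> words_le g k \<Longrightarrow> matrix_unit e w a b \<in> ncpolys_le g k"
proof (rule ncpolys_leI)
  show "bounded_clinear (matrix_unit e w a b w')" for w'
    by (cases "w' = w") (simp_all add: matrix_unit_def bounded_clinear_rank_one)
  show "matrix_unit e w a b w' = (\<lambda>_. 0)" if "w \<in> words_le g k" "w' \<notin> words_le g k" for w'
    using that by (cases "w' = w") (simp_all add: matrix_unit_def)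
qed

text \<open>Let \<open>e\<close> be an orthonormal basis of the span of the finitely many vectors on which \<open>\<phi>\<close>
  depends, with orthogonal projection \<open>\<Pi>\<close>. Then \<open>p\<close> and its compression \<open>\<Pi> p \<Pi>\<close>,
  which is a finite combination of matrix units, have the same entries at these vectors, and so \<open>\<phi>\<close> agrees on them.\<close>

lemma wot_continuous_expansion:
  fixes \<phi> :: "'h::complex_hilbert ncpoly \<Rightarrow> complex"
  assumes lin: "nc_linear_functional g k \<phi>"
    and cont: "continuous_map (nc_product_wot g k) euclidean \<phi>"
  shows "\<exists>(m::nat) e. (\<forall>a<m. \<forall>b<m. cinner (e a) (e b) = (if a = b then 1 else 0)) \<and>
           (\<forall>p\<in>ncpolys_le g k. \<phi> p =
              (\<Sum>w\<in>words_le g k. \<Sum>a<m. \<Sum>b<m. cinner (p w (e a)) (e b) * \<phi> (matrix_unit e w a b)))"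
proof -
  obtain F where "finite F" and F: "\<And>p. \<lbrakk>p \<in> ncpolys_le g k;
      \<forall>w\<in>words_le g k. \<forall>(x, y)\<in>F. cinner (p w x) y = 0\<rbrakk> \<Longrightarrow> \<phi> p = 0"
    using wot_continuous_finite_dependence[OF assms] by blast
  let ?S = "fst ` F \<union> snd ` F"
  have "finite ?S"
    using \<open>finite F\<close> by simp
  from hilbert.orthonormal_Parseval[OF this] obtain m :: nat and e
    where orth: "\<forall>a<m. \<forall>b<m. cinner (e a) (e b) = (if a = b then 1 else 0)"
      and Pars: "\<forall>x\<in>hilbert.span ?S. \<forall>y. cinner x y = (\<Sum>a<m. cinner x (e a) * cinner (e a) y)"
    by blast
  have S: "x \<in> hilbert.span ?S" if "x \<in> ?S" for x
    using that by (rule hilbert.span_base)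
  have "\<phi> p = (\<Sum>w\<in>words_le g k. \<Sum>a<m. \<Sum>b<m. cinner (p w (e a)) (e b) * \<phi> (matrix_unit e w a b))"
    if p: "p \<in> ncpolys_le g k" for p
  proof -
    let ?I = "words_le g k \<times> {..<m} \<times> {..<m}"
    define r :: "'h ncpoly" where
      "r = (\<lambda>w x. \<Sum>(v, a, b)\<in>?I. cinner (p v (e a)) (e b) *\<^sub>C matrix_unit e v a b w x)"
    \<comment> \<open>\<open>r\<close> is the compression \<open>\<Pi> p \<Pi>\<close>.\<close>
    have r_eq: "r w x = (\<Sum>a<m. \<Sum>b<m. cinner (p w (e a)) (e b) *\<^sub>C cinner x (e a) *\<^sub>C e b)"
      if "w \<in> words_le g k" for w x
    proof -
      have "r w x = (\<Sum>v\<in>words_le g k. if v = w then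
          (\<Sum>a<m. \<Sum>b<m. cinner (p w (e a)) (e b) *\<^sub>C cinner x (e a) *\<^sub>C e b) else 0)"
        unfolding r_def sum.cartesian_product[symmetric]
        by (intro sum.cong refl) (simp add: matrix_unit_def)
      then show ?thesis
        using that by simp
    qed
    have r_alt: "r = (\<lambda>w x. \<Sum>i\<in>?I. (case i of (v, a, b) \<Rightarrow> cinner (p v (e a)) (e b)) *\<^sub>C
        (case i of (v, a, b) \<Rightarrow> matrix_unit e v a b) w x)"
      by (simp add: r_def split_def)
    have "\<phi> r = (\<Sum>i\<in>?I. (case i of (v, a, b) \<Rightarrow> cinner (p v (e a)) (e b)) *
        \<phi> (case i of (v, a, b) \<Rightarrow> matrix_unit e v a b))"
      unfolding r_alt by (rule nc_linear_functional_sum[OF lin]) (auto intro: matrix_unit_closed)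
    then have phi_r: "\<phi> r = (\<Sum>w\<in>words_le g k. \<Sum>a<m. \<Sum>b<m.
        cinner (p w (e a)) (e b) * \<phi> (matrix_unit e w a b))"
      by (simp add: sum.cartesian_product split_def)
    have r: "r \<in> ncpolys_le g k"
      unfolding r_def split_def
      using nc_scale_closed[OF matrix_unit_closed, unfolded nc_scale_def]
      by (intro nc_sum_closed) auto
    have same: "cinner (r w x) y = cinner (p w x) y" if w: "w \<in> words_le g k" and xy: "(x, y) \<in> F" for w x y
    proof -
      note A = ncpolys_leD(1)[OF p, of w]
      have x: "x \<in> hilbert.span ?S" and y: "y \<in> hilbert.span ?S"
        using xy by (force intro: S)+
      have "cinner (r w x) y = (\<Sum>a<m. cinner x (e a) * (\<Sum>b<m. cinner (p w (e a)) (e b) * cinner (e b) y))"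
        by (simp add: r_eq[OF w] hilbert.sum_left hilbert.scale_left sum_distrib_left
            mult_ac)
      also have "\<dots> = (\<Sum>a<m. cinner x (e a) * cinner (p w (e a)) y)"
      proof -
        have "(\<Sum>b<m. cinner z (e b) * cinner (e b) y) = cinner z y" for z
        proof -
          have "cinner z y = cnj (\<Sum>b<m. cinner y (e b) * cinner (e b) z)"
            unfolding Pars[rule_format, OF y, of z, symmetric] by (rule hilbert.commute)
          also have "\<dots> = (\<Sum>b<m. cnj (cinner y (e b)) * cnj (cinner (e b) z))"
            by simp
          also have "\<dots> = (\<Sum>b<m. cinner z (e b) * cinner (e b) y)"
            by (simp add: mult.commute flip: hilbert.commute)
          finally show ?thesis ..
        qed
        then show ?thesis by simp
      qed
      also have "\<dots> = (\<Sum>a<m. cinner x (e a) * cinner (e a) (cadjoint (p w) y))"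
        by (simp add: cinner_cadjoint_right[OF A])
      also have "\<dots> = cinner x (cadjoint (p w) y)"
        by (rule Pars[rule_format, OF x, symmetric])
      also have "\<dots> = cinner (p w x) y"
        by (rule cinner_cadjoint_right[OF A])
      finally show ?thesis .
    qed
    let ?q = "nc_add p (nc_scale (-1) r)"
    have "\<phi> ?q = 0"
    proof (rule F)
      show "?q \<in> ncpolys_le g k"
        by (intro nc_add_closed nc_scale_closed p r)
      show "\<forall>w\<in>words_le g k. \<forall>(x, y)\<in>F. cinner (?q w x) y = 0"
        using same by (auto simp: nc_add_def nc_scale_def hilbert.diff_left)
    qed
    moreover have "\<phi> ?q = \<phi> p + (-1) * \<phi> r"
      using lin p r nc_scale_closed[OF r] unfolding nc_linear_functional_def by metis
    ultimately show ?thesis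
      using phi_r by simp
  qed
  with orth show ?thesis
    by blast
qed

text \<open>Splitting \<open>w\<close> after \<open>i\<close> letters is a bijection from pairs \<open>(w, i)\<close> to pairs \<open>(u, v)\<close> with
  \<open>w = u\<^sup>* v\<close>; the first factor is reversed since it comes from the involution. Factorizations with
  a factor that is too long have no counterpart on the right, and the hypothesis makes them vanish.\<close>

lemma words_le_factorizations:
  fixes f :: "nat list \<Rightarrow> nat list \<Rightarrow> nat list \<Rightarrow> 'a::comm_monoid_add"
  assumes "\<And>u v w. u \<notin> words_le g k \<or> v \<notin> words_le g l \<Longrightarrow> f u v w = 0"
  shows "(\<Sum>w\<in>words_le g (k + l). \<Sum>i\<le>length w. f (rev (take i w)) (drop i w) w) =
    (\<Sum>u\<in>words_le g k. \<Sum>v\<in>words_le g l. f u v (rev u @ v))"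
proof -
  let ?D = "SIGMA w:words_le g (k + l). {..length w}"
  let ?E = "words_le g k \<times> words_le g l"
  have "(\<Sum>w\<in>words_le g (k + l). \<Sum>i\<le>length w. f (rev (take i w)) (drop i w) w) =
      (\<Sum>(w, i)\<in>?D. f (rev (take i w)) (drop i w) w)"
    by (simp add: sum.Sigma)
  also have "\<dots> = (\<Sum>(u, v)\<in>?E. f u v (rev u @ v))"
  proof (rule sum.reindex_bij_witness_not_neutral[where
        i = "\<lambda>(u, v). (rev u @ v, length u)" and j = "\<lambda>(w, i). (rev (take i w), drop i w)"
        and S' = "{(w, i) \<in> ?D. (rev (take i w), drop i w) \<notin> ?E}" and T' = "{}"])
    show "finite {(w, i) \<in> ?D. (rev (take i w), drop i w) \<notin> ?E}"
      by (rule finite_subset[of _ ?D]) auto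
    show "(case a of (w, i) \<Rightarrow> f (rev (take i w)) (drop i w) w) = 0"
      if "a \<in> {(w, i) \<in> ?D. (rev (take i w), drop i w) \<notin> ?E}" for a
      using that assms[of "rev (take (snd a) (fst a))" "drop (snd a) (fst a)" "fst a"]
      by (simp add: split_def)
    show "(case b of (u, v) \<Rightarrow> (rev u @ v, length u)) \<in>
        ?D - {(w, i) \<in> ?D. (rev (take i w), drop i w) \<notin> ?E}" if "b \<in> ?E - {}" for b
      using that by (auto simp: words_le_def)
  qed (auto simp: split_def)
  also have "\<dots> = (\<Sum>u\<in>words_le g k. \<Sum>v\<in>words_le g l. f u v (rev u @ v))"
    by (simp add: sum.cartesian_product)
  finally show ?thesis .
qed

text \<open>Adjoints move to the other side of the inner product, so the entries of \<open>q\<^sup>* p\<close> become Gram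
  entries \<open>\<langle>P\<^sub>v e\<^sub>a, Q\<^sub>u e\<^sub>b\<rangle>\<close>.\<close>

lemma expansion_star_mult:
  fixes c :: "nat list \<Rightarrow> nat \<Rightarrow> nat \<Rightarrow> complex" and m :: nat
  assumes q: "q \<in> ncpolys_le g k" and p: "p \<in> ncpolys_le g l"
  shows "(\<Sum>w\<in>words_le g (k + l). \<Sum>a<m. \<Sum>b<m.
            cinner (nc_mult (nc_star q) p w (e a)) (e b) * c w a b) =
    (\<Sum>u\<in>words_le g k. \<Sum>v\<in>words_le g l. \<Sum>a<m. \<Sum>b<m.
            cinner (p v (e a)) (q u (e b)) * c (rev u @ v) a b)"
proof -
  define f where "f u v w = (\<Sum>a<m. \<Sum>b<m. cinner (p v (e a)) (q u (e b)) * c w a b)" for u v w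
  have "(\<Sum>a<m. \<Sum>b<m. cinner (nc_mult (nc_star q) p w (e a)) (e b) * c w a b) =
      (\<Sum>i\<le>length w. f (rev (take i w)) (drop i w) w)" for w
  proof -
    have "(\<Sum>a<m. \<Sum>b<m. cinner (nc_mult (nc_star q) p w (e a)) (e b) * c w a b) =
        (\<Sum>a<m. \<Sum>b<m. \<Sum>i\<le>length w.
          cinner (p (drop i w) (e a)) (q (rev (take i w)) (e b)) * c w a b)"
      by (simp add: nc_mult_def nc_star_def hilbert.sum_left sum_distrib_right
          cinner_cadjoint[OF ncpolys_leD(1)[OF q]])
    also have "\<dots> = (\<Sum>a<m. \<Sum>i\<le>length w. \<Sum>b<m.
          cinner (p (drop i w) (e a)) (q (rev (take i w)) (e b)) * c w a b)"
      by (intro sum.cong refl sum.swap)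
    also have "\<dots> = (\<Sum>i\<le>length w. f (rev (take i w)) (drop i w) w)"
      unfolding f_def by (rule sum.swap)
    finally show ?thesis .
  qed
  then have "(\<Sum>w\<in>words_le g (k + l). \<Sum>a<m. \<Sum>b<m.
            cinner (nc_mult (nc_star q) p w (e a)) (e b) * c w a b) =
      (\<Sum>w\<in>words_le g (k + l). \<Sum>i\<le>length w. f (rev (take i w)) (drop i w) w)"
    by simp
  also have "\<dots> = (\<Sum>u\<in>words_le g k. \<Sum>v\<in>words_le g l. f u v (rev u @ v))"
  proof (rule words_le_factorizations)
    show "f u v w = 0" if "u \<notin> words_le g k \<or> v \<notin> words_le g l" for u v w
      using that ncpolys_leD(2)[OF q, of u] ncpolys_leD(2)[OF p, of v] by (auto simp: f_def)
  qed
  finally show ?thesis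
    by (simp add: f_def)
qed

section \<open>The truncated moment problem for matrix moments\<close>

lemma mat_word_simps:
  "mat_word n Y [] = 1\<^sub>m n" "mat_word n Y (k # w) = Y k * mat_word n Y w"
  by (simp_all add: mat_word_def)

lemma mat_word_carrier:
  assumes "\<And>k. k \<in> set w \<Longrightarrow> Y k \<in> carrier_mat n n"
  shows "mat_word n Y w \<in> carrier_mat n n"
  using assms by (induction w) (auto simp: mat_word_simps intro: mult_carrier_mat)

lemma mat_word_Cons_vec:
  assumes "\<And>j. j \<in> set (k # w) \<Longrightarrow> Y j \<in> carrier_mat n n" and "x \<in> carrier_vec n"
  shows "mat_word n Y (k # w) *\<^sub>v x = Y k *\<^sub>v (mat_word n Y w *\<^sub>v x)"
  unfolding mat_word_simps
  by (rule assoc_mult_mat_vec[of _ n n _ n]) (use assms mat_word_carrier[of w Y n] in auto)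

text \<open>Since the letters are self-adjoint, reversing a word amounts to taking the adjoint.\<close>

lemma mat_word_adjoint:
  assumes Y: "\<And>k. k \<in> set u \<union> set v \<Longrightarrow> self_adjoint_on n (Y k)"
    and x: "x \<in> carrier_vec n" and y: "y \<in> carrier_vec n"
  shows "(mat_word n Y (rev u @ v) *\<^sub>v x) \<bullet>c y = (mat_word n Y v *\<^sub>v x) \<bullet>c (mat_word n Y u *\<^sub>v y)"
  using Y
proof (induction u arbitrary: v)
  case Nil
  then show ?case
    using y by (simp add: mat_word_simps)
next
  case (Cons k u)
  have carr: "Y j \<in> carrier_mat n n" if "j \<in> set (k # u) \<union> set v" for j
    using Cons.prems[OF that] by (simp add: self_adjoint_on_def)
  have vx: "mat_word n Y v *\<^sub>v x \<in> carrier_vec n"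
    by (rule mult_mat_vec_carrier[OF mat_word_carrier x]) (use carr in simp)
  have uy: "mat_word n Y u *\<^sub>v y \<in> carrier_vec n"
    by (rule mult_mat_vec_carrier[OF mat_word_carrier y]) (use carr in simp)
  have "(mat_word n Y (rev (k # u) @ v) *\<^sub>v x) \<bullet>c y =
      (mat_word n Y (k # v) *\<^sub>v x) \<bullet>c (mat_word n Y u *\<^sub>v y)"
    using Cons.IH[of "k # v"] Cons.prems by simp
  also have "\<dots> = (Y k *\<^sub>v (mat_word n Y v *\<^sub>v x)) \<bullet>c (mat_word n Y u *\<^sub>v y)"
    by (subst mat_word_Cons_vec[OF _ x]) (use carr in auto)
  also have "\<dots> = (mat_word n Y v *\<^sub>v x) \<bullet>c (Y k *\<^sub>v (mat_word n Y u *\<^sub>v y))"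
    using Cons.prems[of k] vx uy by (simp add: self_adjoint_on_def)
  also have "Y k *\<^sub>v (mat_word n Y u *\<^sub>v y) = mat_word n Y (k # u) *\<^sub>v y"
    by (subst mat_word_Cons_vec[OF _ y]) (use carr in auto)
  finally show ?case .
qed

text \<open>The truncated GNS construction. The form \<open>B\<close> lives on functions of a word and an index, and only
  their values on words of length at most \<open>d + 1\<close> matter to it. Up to null vectors, the
  system \<open>u\<close> spans the words of length at most \<open>d\<close>, on which the shifts \<open>X k\<close> are symmetric by the Hankel structure. A word of length
  at most \<open>2 d + 1\<close> is reached because it factors as \<open>s\<^sup>* t\<close> with \<open>s\<close> of length at most \<open>d\<close> and \<open>t\<close>
  of length at most \<open>d + 1\<close>; only \<open>t\<close> can leave the span, and it is paired with \<open>s\<close>, which cannot.\<close>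

lemma truncated_matrix_moments:
  fixes c :: "nat list \<Rightarrow> nat \<Rightarrow> nat \<Rightarrow> complex" and g d m :: nat
  assumes pos: "\<And>t :: nat list \<Rightarrow> nat \<Rightarrow> complex.
    0 \<le> (\<Sum>u\<in>words_le g (d + 1). \<Sum>v\<in>words_le g (d + 1). \<Sum>a<m. \<Sum>b<m.
            c (rev u @ v) a b * (t v a * cnj (t u b)))"
  shows "\<exists>n (Y :: nat \<Rightarrow> complex mat) G. (\<forall>k<g. self_adjoint_on n (Y k)) \<and>
    (\<forall>a<m. G a \<in> carrier_vec n) \<and>
    (\<forall>w\<in>words_le g (2 * d + 1). \<forall>a<m. \<forall>b<m. (mat_word n Y w *\<^sub>v G a) \<bullet>c G b = c w a b)"
proof -
  let ?W = "words_le g (d + 1)"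
  let ?scale = "\<lambda>(z::complex) (t :: nat list \<Rightarrow> nat \<Rightarrow> complex) w a. z * t w a"
  define B where "B t s = (\<Sum>u\<in>?W. \<Sum>v\<in>?W. \<Sum>a<m. \<Sum>b<m.
      c (rev u @ v) a b * (t v a * cnj (s u b)))" for t s :: "nat list \<Rightarrow> nat \<Rightarrow> complex"
  interpret positive_form ?scale B
  proof
    fix x y z :: "nat list \<Rightarrow> nat \<Rightarrow> complex" and r s :: complex
    show "?scale r (x + y) = ?scale r x + ?scale r y" "?scale (r + s) x = ?scale r x + ?scale s x"
      "?scale r (?scale s x) = ?scale (r * s) x" "?scale 1 x = x"
      by (simp_all add: fun_eq_iff algebra_simps)
    show "B (x + y) z = B x z + B y z" "B x (y + z) = B x y + B x z"
      by (simp_all add: B_def algebra_simps sum.distrib)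
    show "B (?scale r x) y = r * B x y" "B x (?scale r y) = cnj r * B x y"
      by (simp_all add: B_def sum_distrib_left mult_ac)
    show "0 \<le> B x x"
      unfolding B_def by (rule pos)
  qed
  define \<delta> :: "nat list \<Rightarrow> nat \<Rightarrow> nat list \<Rightarrow> nat \<Rightarrow> complex" where
    "\<delta> v a = (\<lambda>w b. if w = v \<and> b = a then 1 else 0)" for v a
  have B_delta: "B (\<delta> v a) (\<delta> u b) = c (rev u @ v) a b"
    if "v \<in> ?W" "u \<in> ?W" "a < m" "b < m" for u v a b
  proof -
    have "B (\<delta> v a) (\<delta> u b) = (\<Sum>x\<in>?W \<times> ?W \<times> {..<m} \<times> {..<m}.
        if x = (u, v, a, b) then c (rev u @ v) a b else 0)"
      unfolding B_def sum.cartesian_product by (intro sum.cong refl) (auto simp: \<delta>_def split: if_splits)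
    then show ?thesis
      using that by simp
  qed
  define S where "S = (\<lambda>(v, a). \<delta> v a) ` (words_le g d \<times> {..<m})"
  have "finite S"
    by (simp add: S_def)
  from orthonormal_Parseval[OF this] obtain n :: nat and u where nu: "(\<forall>i<n. u i \<in> span S) \<and>
      (\<forall>i<n. \<forall>j<n. B (u i) (u j) = (if i = j then 1 else 0)) \<and>
      (\<forall>x\<in>span S. \<forall>y. B x y = (\<Sum>i<n. B x (u i) * B (u i) y))"
    by (elim exE)
  then have u: "\<And>i. i < n \<Longrightarrow> u i \<in> span S"
    and Pars: "\<And>x y. x \<in> span S \<Longrightarrow> B x y = (\<Sum>i<n. B x (u i) * B (u i) y)"
    by blast+
  \<comment> \<open>Left multiplication by the letter \<open>k\<close>: it maps \<open>\<delta> v a\<close> to \<open>\<delta> (k # v) a\<close>.\<close>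
  define X :: "nat \<Rightarrow> (nat list \<Rightarrow> nat \<Rightarrow> complex) \<Rightarrow> nat list \<Rightarrow> nat \<Rightarrow> complex" where
    "X k t = (\<lambda>w a. case w of [] \<Rightarrow> 0 | j # v \<Rightarrow> if j = k then t v a else 0)" for k t
  have X_delta: "X k (\<delta> v a) = \<delta> (k # v) a" for k v a
    by (auto simp: X_def \<delta>_def fun_eq_iff split: list.split)
  have X_lin: "X k 0 = 0" "X k (?scale r x + z) = ?scale r (X k x) + X k z" for k r x z
    by (auto simp: X_def fun_eq_iff split: list.split)
  have W: "v \<in> words_le g d \<Longrightarrow> v \<in> ?W" for v
    by (auto simp: words_le_def)
  have kW: "k < g \<Longrightarrow> v \<in> words_le g d \<Longrightarrow> k # v \<in> ?W" for k v
    by (auto simp: words_le_def)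
  have sym: "B (X k x) y = B x (X k y)" if k: "k < g" and x: "x \<in> span S" and y: "y \<in> span S" for k x y
  proof -
    have gens: "B (X k s) t = B s (X k t)" if st: "s \<in> S" "t \<in> S" for s t
    proof -
      from st obtain v a w b where "s = \<delta> v a" "t = \<delta> w b"
        and vw: "v \<in> words_le g d" "w \<in> words_le g d" and ab: "a < m" "b < m"
        by (auto simp: S_def)
      then show ?thesis
        using B_delta[OF kW[OF k vw(1)] W[OF vw(2)] ab] B_delta[OF W[OF vw(1)] kW[OF k vw(2)] ab]
        by (simp add: X_delta)
    qed
    have "B (X k s) y = B s (X k y)" if "s \<in> S" for s
      using y
    proof (induction rule: span_induct_alt)
      case base
      show ?case by (simp only: X_lin zero_right)
    next
      case (step r t z)
      then show ?case
        using gens[OF that step.hyps(1)] by (simp only: X_lin add_right scale_right)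
    qed
    with x show ?thesis
    proof (induction rule: span_induct_alt)
      case base
      show ?case by (simp only: X_lin zero_left)
    next
      case (step r t z)
      then show ?case
        by (simp only: X_lin add_left scale_left)
    qed
  qed
  define Y where "Y k = mat n n (\<lambda>(i, j). B (X k (u j)) (u i))" for k
  have Y: "self_adjoint_on n (Y k)"
    and Y_vec: "t \<in> span S \<Longrightarrow> Y k *\<^sub>v vec n (\<lambda>i. B t (u i)) = vec n (\<lambda>i. B (X k t) (u i))"
    if "k < g" for k t
  proof -
    note compression = compression_matrix[where n = n and u = u and S = S and X = "X k",
        OF u Pars sym[OF that]]
    show "self_adjoint_on n (Y k)"
      unfolding Y_def by (rule compression(1))
    show "Y k *\<^sub>v vec n (\<lambda>i. B t (u i)) = vec n (\<lambda>i. B (X k t) (u i))" if "t \<in> span S"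
      unfolding Y_def by (rule compression(2)) (use that in simp_all)
  qed
  have Y_dim: "Y k \<in> carrier_mat n n" for k
    by (simp add: Y_def)
  define G where "G a = vec n (\<lambda>i. B (\<delta> [] a) (u i))" for a
  have G: "G a \<in> carrier_vec n" for a
    by (simp add: G_def)
  \<comment> \<open>Each letter is applied to a word of length at most \<open>d\<close>, so the compression acts there as the
    shift itself, up to projection of the outcome.\<close>
  have word: "mat_word n Y v *\<^sub>v G a = vec n (\<lambda>i. B (\<delta> v a) (u i))" if "v \<in> ?W" "a < m" for v a
    using that
  proof (induction v)
    case Nil
    show ?case
      using one_mult_mat_vec[OF G] by (simp add: mat_word_simps G_def)
  next
    case (Cons k v)
    then have k: "k < g" and v: "v \<in> words_le g d"
      by (auto simp: words_le_def)
    have "\<delta> v a \<in> span S"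
      using v Cons.prems by (intro span_base) (auto simp: S_def)
    then show ?case
      using Cons.IH[OF W[OF v]] Cons.prems Y_vec[OF k]
      by (simp add: mat_word_Cons_vec[OF Y_dim G] X_delta)
  qed
  have "(mat_word n Y w *\<^sub>v G a) \<bullet>c G b = c w a b"
    if w: "w \<in> words_le g (2 * d + 1)" and ab: "a < m" "b < m" for w a b
  proof -
    define s t where "s = rev (take d w)" and "t = drop d w"
    have w_eq: "w = rev s @ t"
      by (simp add: s_def t_def)
    have s: "s \<in> words_le g d" and t: "t \<in> ?W"
      using w by (auto simp: words_le_def s_def t_def dest: in_set_takeD in_set_dropD)
    have "k < g" if "k \<in> set s \<union> set t" for k
      using that s t by (auto simp: words_le_def)
    then have "(mat_word n Y w *\<^sub>v G a) \<bullet>c G b = (mat_word n Y t *\<^sub>v G a) \<bullet>c (mat_word n Y s *\<^sub>v G b)"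
      unfolding w_eq by (intro mat_word_adjoint Y G)
    also have "\<dots> = (\<Sum>i<n. B (\<delta> t a) (u i) * cnj (B (\<delta> s b) (u i)))"
      using word[OF t ab(1)] word[OF W[OF s] ab(2)] by (simp add: scalar_prod_def atLeast0LessThan)
    also have "\<dots> = cnj (\<Sum>i<n. B (\<delta> s b) (u i) * B (u i) (\<delta> t a))"
      by (simp add: mult.commute flip: commute)
    also have "\<dots> = cnj (B (\<delta> s b) (\<delta> t a))"
      by (subst Pars) (use s ab in \<open>auto simp: S_def intro: span_base\<close>)
    also have "\<dots> = c w a b"
      using B_delta[OF t W[OF s] ab] by (simp add: w_eq flip: commute)
    finally show ?thesis .
  qed
  with Y G show ?thesis
    by blast
qed

section \<open>Evaluation at a tuple of matrices\<close>

text \<open>The vectors \<open>x\<close> and \<open>y\<close> are sums of elementary tensors \<open>h\<^sub>k \<otimes> f\<^sub>k\<close>.\<close>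

lemma tensor_cinner_sums:
  assumes "\<And>k. k \<in> I \<Longrightarrow> f k \<in> carrier_vec n" "\<And>l. l \<in> J \<Longrightarrow> f' l \<in> carrier_vec n"
    and x: "x = vec n (\<lambda>i. \<Sum>k\<in>I. f k $ i *\<^sub>C h k)"
    and y: "y = vec n (\<lambda>i. \<Sum>l\<in>J. f' l $ i *\<^sub>C h' l)"
  shows "tensor_cinner x y = (\<Sum>k\<in>I. \<Sum>l\<in>J. cinner (h k) (h' l) * (f k \<bullet>c f' l))"
proof -
  have "tensor_cinner x y = (\<Sum>i<n. \<Sum>k\<in>I. \<Sum>l\<in>J. cinner (h k) (h' l) * (f k $ i * cnj (f' l $ i)))"
    unfolding tensor_cinner_def x y
    by (simp add: hilbert.sum_left hilbert.scale_left)
      (simp add: hilbert.sum_right hilbert.scale_right sum_distrib_left mult_ac)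
  also have "\<dots> = (\<Sum>k\<in>I. \<Sum>i<n. \<Sum>l\<in>J. cinner (h k) (h' l) * (f k $ i * cnj (f' l $ i)))"
    by (rule sum.swap)
  also have "\<dots> = (\<Sum>k\<in>I. \<Sum>l\<in>J. \<Sum>i<n. cinner (h k) (h' l) * (f k $ i * cnj (f' l $ i)))"
    by (intro sum.cong refl sum.swap)
  also have "\<dots> = (\<Sum>k\<in>I. \<Sum>l\<in>J. cinner (h k) (h' l) * (f k \<bullet>c f' l))"
    using carrier_vecD[OF assms(1)] carrier_vecD[OF assms(2)]
    by (intro sum.cong refl) (simp add: scalar_prod_def atLeast0LessThan sum_distrib_left)
  finally show ?thesis .
qed

lemma nc_eval_sum:
  fixes m :: nat
  assumes p: "p \<in> ncpolys_le g k"
    and Y: "\<And>i. i < g \<Longrightarrow> Y i \<in> carrier_mat n n"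
    and G: "\<And>a. a < m \<Longrightarrow> G a \<in> carrier_vec n"
  shows "nc_eval n Y p (vec n (\<lambda>i. \<Sum>a<m. G a $ i *\<^sub>C e a)) =
    vec n (\<lambda>i. \<Sum>(w, a)\<in>words_le g k \<times> {..<m}. (mat_word n Y w *\<^sub>v G a) $ i *\<^sub>C p w (e a))"
proof (rule eq_vecI)
  let ?v = "vec n (\<lambda>i. \<Sum>a<m. G a $ i *\<^sub>C e a)"
  fix i
  assume "i < dim_vec (vec n (\<lambda>i. \<Sum>(w, a)\<in>words_le g k \<times> {..<m}.
      (mat_word n Y w *\<^sub>v G a) $ i *\<^sub>C p w (e a)))"
  then have i: "i < n" by simp
  have op: "tensor_op (p w) (mat_word n Y w) ?v $ i =
      (\<Sum>a<m. (mat_word n Y w *\<^sub>v G a) $ i *\<^sub>C p w (e a))" if w: "w \<in> words_le g k" for w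
  proof -
    note A = ncpolys_leD(1)[OF p, of w]
    define M where "M = mat_word n Y w"
    have M: "M \<in> carrier_mat n n"
      unfolding M_def using w Y by (intro mat_word_carrier) (auto simp: words_le_def)
    have "tensor_op (p w) M ?v $ i = (\<Sum>j<n. \<Sum>a<m. (M $$ (i, j) * G a $ j) *\<^sub>C p w (e a))"
      using M i by (simp add: tensor_op_def bounded_clinearD[OF A] hilbert.scale_sum_right)
    also have "\<dots> = (\<Sum>a<m. \<Sum>j<n. (M $$ (i, j) * G a $ j) *\<^sub>C p w (e a))"
      by (rule sum.swap)
    also have "\<dots> = (\<Sum>a<m. (M *\<^sub>v G a) $ i *\<^sub>C p w (e a))"
      using M i carrier_vecD[OF G] by (intro sum.cong refl)
        (simp add: scalar_prod_def atLeast0LessThan hilbert.scale_sum_left)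
    finally show ?thesis
      unfolding M_def .
  qed
  have "nc_eval n Y p ?v $ i = (\<Sum>w\<in>nc_support p. tensor_op (p w) (mat_word n Y w) ?v $ i)"
    using i by (simp add: nc_eval_def)
  also have "\<dots> = (\<Sum>w\<in>nc_support p. \<Sum>a<m. (mat_word n Y w *\<^sub>v G a) $ i *\<^sub>C p w (e a))"
    using p op by (intro sum.cong refl) (auto simp: ncpolys_le_iff)
  also have "\<dots> = (\<Sum>w\<in>words_le g k. \<Sum>a<m. (mat_word n Y w *\<^sub>v G a) $ i *\<^sub>C p w (e a))"
    using p by (intro sum.mono_neutral_left) (auto simp: ncpolys_le_iff nc_support_def)
  finally show "nc_eval n Y p ?v $ i = vec n (\<lambda>i. \<Sum>(w, a)\<in>words_le g k \<times> {..<m}.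
      (mat_word n Y w *\<^sub>v G a) $ i *\<^sub>C p w (e a)) $ i"
    using i by (simp add: sum.cartesian_product)
qed (simp add: nc_eval_def)

section \<open>Representation of the functional\<close>

theorem proposition5p4:
  fixes g d :: nat and \<phi> :: "'h::complex_hilbert ncpoly \<Rightarrow> complex"
  assumes "g > 0" and "d > 0"
    and "nc_linear_functional g (2 * d + 2) \<phi>"
    and "continuous_map (nc_product_wot g (2 * d + 2)) euclidean \<phi>"
    and "\<forall>p \<in> ncpolys_le g (d + 1). 0 \<le> \<phi> (nc_mult (nc_star p) p)"
  shows "\<exists>n (Y :: nat \<Rightarrow> complex mat) \<gamma>.
           (\<forall>i<g. self_adjoint_on n (Y i)) \<and> \<gamma> \<in> tensor_space n \<and>
           (\<forall>p \<in> ncpolys_le g (d + 1). \<forall>q \<in> ncpolys_le g d.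
              \<phi> (nc_mult (nc_star q) p) = tensor_cinner (nc_eval n Y p \<gamma>) (nc_eval n Y q \<gamma>)) \<and>
           (\<forall>p \<in> ncpolys_le g (2 * d + 1). \<phi> p = tensor_cinner (nc_eval n Y p \<gamma>) \<gamma>)"
proof -
  obtain m :: nat and e
    where orth: "\<forall>a<m. \<forall>b<m. cinner (e a) (e b) = (if a = b then 1 else 0)"
      and expand: "\<forall>p\<in>ncpolys_le g (2 * d + 2). \<phi> p = (\<Sum>w\<in>words_le g (2 * d + 2). \<Sum>a<m. \<Sum>b<m.
        cinner (p w (e a)) (e b) * \<phi> (matrix_unit e w a b))"
    using wot_continuous_expansion[OF assms(3,4)] by blast
  define c where "c w a b = \<phi> (matrix_unit e w a b)" for w a b
  have phi: "\<phi> p = (\<Sum>w\<in>words_le g k. \<Sum>a<m. \<Sum>b<m. cinner (p w (e a)) (e b) * c w a b)"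
    if p: "p \<in> ncpolys_le g k" and k: "k \<le> 2 * d + 2" for p k
  proof -
    have "p \<in> ncpolys_le g (2 * d + 2)"
      using p ncpolys_le_mono[OF k] by blast
    then have "\<phi> p = (\<Sum>w\<in>words_le g (2 * d + 2). \<Sum>a<m. \<Sum>b<m. cinner (p w (e a)) (e b) * c w a b)"
      using expand by (simp add: c_def)
    also have "\<dots> = (\<Sum>w\<in>words_le g k. \<Sum>a<m. \<Sum>b<m. cinner (p w (e a)) (e b) * c w a b)"
      using words_le_mono[OF k] by (intro sum.mono_neutral_right) (simp_all add: ncpolys_leD(2)[OF p])
    finally show ?thesis .
  qed
  have phi_star: "\<phi> (nc_mult (nc_star q) p) = (\<Sum>u\<in>words_le g k. \<Sum>v\<in>words_le g l. \<Sum>a<m. \<Sum>b<m.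
      cinner (p v (e a)) (q u (e b)) * c (rev u @ v) a b)"
    if "q \<in> ncpolys_le g k" "p \<in> ncpolys_le g l" "k + l \<le> 2 * d + 2" for p q k l
    using phi[OF nc_star_mult_closed that(3)] that expansion_star_mult[of q g k p l] by simp
  have pos: "0 \<le> (\<Sum>u\<in>words_le g (d + 1). \<Sum>v\<in>words_le g (d + 1). \<Sum>a<m. \<Sum>b<m.
            c (rev u @ v) a b * (t v a * cnj (t u b)))" for t :: "nat list \<Rightarrow> nat \<Rightarrow> complex"
  proof -
    \<comment> \<open>The polynomial with \<open>P\<^sub>w e\<^sub>a = t w a e\<^sub>0\<close>. If \<open>m = 0\<close>, then \<open>e 0\<close> is arbitrary, but all sums
      over indices are empty.\<close>
    define p :: "'h ncpoly" where
      "p = (\<lambda>w x. if w \<in> words_le g (d + 1) then \<Sum>a<m. t w a *\<^sub>C cinner x (e a) *\<^sub>C e 0 else 0)"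
    have p: "p \<in> ncpolys_le g (d + 1)"
    proof (rule ncpolys_leI)
      show "bounded_clinear (p w)" if "w \<in> words_le g (d + 1)" for w
        unfolding p_def if_P[OF that]
        by (intro bounded_clinear_sum bounded_clinear_scale bounded_clinear_rank_one)
    qed (simp add: p_def)
    have pe: "p w (e a) = t w a *\<^sub>C e 0" if "w \<in> words_le g (d + 1)" "a < m" for w a
    proof -
      have "p w (e a) = (\<Sum>b<m. if b = a then t w b *\<^sub>C e 0 else 0)"
        unfolding p_def if_P[OF that(1)] using that orth by (intro sum.cong refl) auto
      then show ?thesis
        using that by simp
    qed
    have deg: "(d + 1) + (d + 1) \<le> 2 * d + 2"
      by simp
    have "(\<Sum>u\<in>words_le g (d + 1). \<Sum>v\<in>words_le g (d + 1). \<Sum>a<m. \<Sum>b<m.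
            c (rev u @ v) a b * (t v a * cnj (t u b))) = \<phi> (nc_mult (nc_star p) p)"
      unfolding phi_star[OF p p deg]
    proof (intro sum.cong refl)
      fix u v a b
      assume uv: "u \<in> words_le g (d + 1)" "v \<in> words_le g (d + 1)" and "a \<in> {..<m}" "b \<in> {..<m}"
      then have ab: "a < m" "b < m" and "cinner (e 0) (e 0) = 1"
        using orth by auto
      then show "c (rev u @ v) a b * (t v a * cnj (t u b)) =
          cinner (p v (e a)) (p u (e b)) * c (rev u @ v) a b"
        by (simp add: pe[OF uv(2) ab(1)] pe[OF uv(1) ab(2)] hilbert.scale_left hilbert.scale_right)
    qed
    then show ?thesis
      using assms(5) p by simp
  qed
  obtain n and Y :: "nat \<Rightarrow> complex mat" and G
    where Y: "\<And>k. k < g \<Longrightarrow> self_adjoint_on n (Y k)"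
      and G: "\<And>a. a < m \<Longrightarrow> G a \<in> carrier_vec n"
      and moments: "\<And>w a b. \<lbrakk>w \<in> words_le g (2 * d + 1); a < m; b < m\<rbrakk> \<Longrightarrow>
        (mat_word n Y w *\<^sub>v G a) \<bullet>c G b = c w a b"
    using truncated_matrix_moments[where g = g and d = d and m = m and c = c, OF pos] by blast
  have Y_dim: "Y k \<in> carrier_mat n n" if "k < g" for k
    using Y[OF that] by (simp add: self_adjoint_on_def)
  have word_dim: "mat_word n Y w *\<^sub>v G a \<in> carrier_vec n" if "w \<in> words_le g k" "a < m" for w a k
    using that by (intro mult_mat_vec_carrier[OF mat_word_carrier G] Y_dim) (auto simp: words_le_def)
  define \<gamma> where "\<gamma> = vec n (\<lambda>i. \<Sum>a<m. G a $ i *\<^sub>C e a)"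
  have eval: "nc_eval n Y p \<gamma> = vec n (\<lambda>i. \<Sum>k\<in>words_le g l \<times> {..<m}.
      (mat_word n Y (fst k) *\<^sub>v G (snd k)) $ i *\<^sub>C p (fst k) (e (snd k)))"
    if "p \<in> ncpolys_le g l" for p l
    using nc_eval_sum[OF that Y_dim G] unfolding \<gamma>_def split_def .
  have first: "\<phi> (nc_mult (nc_star q) p) = tensor_cinner (nc_eval n Y p \<gamma>) (nc_eval n Y q \<gamma>)"
    if p: "p \<in> ncpolys_le g (d + 1)" and q: "q \<in> ncpolys_le g d" for p q
  proof -
    let ?P = "words_le g (d + 1) \<times> {..<m}" and ?Q = "words_le g d \<times> {..<m}"
    have mom: "(mat_word n Y v *\<^sub>v G a) \<bullet>c (mat_word n Y u *\<^sub>v G b) = c (rev u @ v) a b"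
      if uv: "u \<in> words_le g d" "v \<in> words_le g (d + 1)" and ab: "a < m" "b < m" for u v a b
    proof -
      have "rev u @ v \<in> words_le g (2 * d + 1)"
        using uv by (auto simp: words_le_def)
      moreover have "(mat_word n Y (rev u @ v) *\<^sub>v G a) \<bullet>c G b =
          (mat_word n Y v *\<^sub>v G a) \<bullet>c (mat_word n Y u *\<^sub>v G b)"
        by (rule mat_word_adjoint[OF Y G[OF ab(1)] G[OF ab(2)]]) (use uv in \<open>auto simp: words_le_def\<close>)
      ultimately show ?thesis
        using moments ab by simp
    qed
    have "tensor_cinner (nc_eval n Y p \<gamma>) (nc_eval n Y q \<gamma>) = (\<Sum>k\<in>?P. \<Sum>l\<in>?Q.
        cinner (p (fst k) (e (snd k))) (q (fst l) (e (snd l))) *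
        ((mat_word n Y (fst k) *\<^sub>v G (snd k)) \<bullet>c (mat_word n Y (fst l) *\<^sub>v G (snd l))))"
      by (rule tensor_cinner_sums[OF _ _ eval[OF p] eval[OF q]]) (auto intro: word_dim)
    also have "\<dots> = (\<Sum>k\<in>?P. \<Sum>l\<in>?Q.
        cinner (p (fst k) (e (snd k))) (q (fst l) (e (snd l))) * c (rev (fst l) @ fst k) (snd k) (snd l))"
      by (intro sum.cong refl) (auto simp: mom)
    also have "\<dots> = (\<Sum>v\<in>words_le g (d + 1). \<Sum>a<m. \<Sum>u\<in>words_le g d. \<Sum>b<m.
        cinner (p v (e a)) (q u (e b)) * c (rev u @ v) a b)"
      by (simp only: sum.cartesian_product' fst_conv snd_conv)
    also have "\<dots> = (\<Sum>v\<in>words_le g (d + 1). \<Sum>u\<in>words_le g d. \<Sum>a<m. \<Sum>b<m.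
        cinner (p v (e a)) (q u (e b)) * c (rev u @ v) a b)"
      by (intro sum.cong refl sum.swap)
    also have "\<dots> = (\<Sum>u\<in>words_le g d. \<Sum>v\<in>words_le g (d + 1). \<Sum>a<m. \<Sum>b<m.
        cinner (p v (e a)) (q u (e b)) * c (rev u @ v) a b)"
      by (rule sum.swap)
    also have "\<dots> = \<phi> (nc_mult (nc_star q) p)"
      by (rule phi_star[OF q p, symmetric]) simp
    finally show ?thesis ..
  qed
  have second: "\<phi> p = tensor_cinner (nc_eval n Y p \<gamma>) \<gamma>" if p: "p \<in> ncpolys_le g (2 * d + 1)" for p
  proof -
    let ?P = "words_le g (2 * d + 1) \<times> {..<m}"
    have "tensor_cinner (nc_eval n Y p \<gamma>) \<gamma> = (\<Sum>k\<in>?P. \<Sum>b<m.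
        cinner (p (fst k) (e (snd k))) (e b) * ((mat_word n Y (fst k) *\<^sub>v G (snd k)) \<bullet>c G b))"
      by (rule tensor_cinner_sums[OF _ _ eval[OF p] \<gamma>_def]) (auto intro: word_dim G)
    also have "\<dots> = (\<Sum>k\<in>?P. \<Sum>b<m. cinner (p (fst k) (e (snd k))) (e b) * c (fst k) (snd k) b)"
      by (intro sum.cong refl) (auto simp: moments)
    also have "\<dots> = (\<Sum>w\<in>words_le g (2 * d + 1). \<Sum>a<m. \<Sum>b<m. cinner (p w (e a)) (e b) * c w a b)"
      by (simp only: sum.cartesian_product' fst_conv snd_conv)
    also have "\<dots> = \<phi> p"
      by (rule phi[OF p, symmetric]) simp
    finally show ?thesis ..
  qed
  have "\<gamma> \<in> tensor_space n"
    by (simp add: \<gamma>_def tensor_space_def)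
  with Y first second show ?thesis
    by blast
qed

end
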